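(* Let $L>0$ vary and let $\sigma:\mathbb{Z}'\to[0,1]$ satisfy $\sum_{l\in\mathbb{Z}',\,l<0}\sigma(l)<\infty$. For $s\in\mathbb{Z}'$ let $Q^0_\sigma(s):=\prod_{i=1}^{\infty}\bigl(1-\sigma(-i-s)\bigr)$. For every $s\in\mathbb{Z}'$ with $Q^0_\sigma(s)>0$ there exists $L_*=L_*(s)>0$ such that $Q_\sigma(L,s)>0$ for $0\le L<L_*$, and \[ \log Q_\sigma(L,s)=\log Q^0_\sigma(s)-\frac{\sigma(-s)-\sigma(-s-1)}{1-\sigma(-1-s)}L^2+\mathrm O(L^4),\qquad L\to 0. \]
   Context: $\mathbb{Z}'=\mathbb{Z}+\tfrac12$. $\mathrm{J}_k$ denotes the Bessel function of the first kind of order $k$. For $L\ge0$ and $\sigma$ as in the claim, define the kernel $K_\sigma(a,b)=\sum_{l\in\mathbb{Z}'}\sigma(l)\mathrm{J}_{a+l}(2L)\mathrm{J}_{b+l}(2L)$ for $a,b\in\mathbb{Z}'$; a kernel $X$ induces the operator $(\mathcal X\psi)(a)=\sum_{b\in\mathbb{Z}'}X(a,b)\psi(b)$ on $\ell^2(\mathbb{Z}')$. For $s\in\mathbb{Z}'$, $P_s$ is the orthogonal projection onto $\ell^2(\{s+1,s+2,\dots\})$. The operator $P_s\mathcal K_\sigma P_s$ is trace class and $Q_\sigma(L,s):=\det(1-P_s\mathcal K_\sigma P_s)$ (Fredholm determinant), the probability that the largest particle of the determinantal point process with kernel $K_\sigma$ is $\le s$. *)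

theory Defs
  imports "HOL-Analysis.Analysis" "HOL-Library.Landau_Symbols" "Jordan_Normal_Form.Determinant"
begin

definition Zp :: "real set" where
  "Zp = {real_of_int k + 1/2 | k. True}"

definition BesselJ :: "int \<Rightarrow> real \<Rightarrow> real" where
  "BesselJ n x =
     (if 0 \<le> n then
        (\<Sum>m. (-1) ^ m / (fact m * fact (m + nat n)) * (x / 2) ^ (2 * m + nat n))
      else
        (-1) ^ nat (- n) *
        (\<Sum>m. (-1) ^ m / (fact m * fact (m + nat (- n))) * (x / 2) ^ (2 * m + nat (- n))))"

text \<open>The kernel K_sigma(a,b) = sum over l in Z' of sigma(l) J_{a+l}(2L) J_{b+l}(2L), a,b in Z'.
  For a, l in Z' the order a+l is an integer, which we extract with the floor.\<close>
definition Ksig :: "(real \<Rightarrow> real) \<Rightarrow> real \<Rightarrow> real \<Rightarrow> real \<Rightarrow> real" where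
  "Ksig \<sigma> L a b =
     (\<Sum>\<^sub>\<infinity>l\<in>Zp. \<sigma> l * BesselJ \<lfloor>a + l\<rfloor> (2 * L) * BesselJ \<lfloor>b + l\<rfloor> (2 * L))"

text \<open>Fredholm determinant det(1 - K) of (the operator with) kernel K on l^2(S), S countable,
  given by Fredholm's series
  det(1-K) = sum_n (-1)^n / n! * sum_{(x_1..x_n) in S^n} det [K(x_i,x_j)]_{i,j}.\<close>
definition fredholm_det :: "('a \<Rightarrow> 'a \<Rightarrow> real) \<Rightarrow> 'a set \<Rightarrow> real" where
  "fredholm_det K S =
     (\<Sum>n. (-1) ^ n / fact n *
        (\<Sum>\<^sub>\<infinity>xs\<in>{xs. length xs = n \<and> set xs \<subseteq> S}.
            Determinant.det (mat n n (\<lambda>(i, j). K (xs ! i) (xs ! j)))))"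

text \<open>Q_sigma(L,s) = det(1 - P_s K_sigma P_s), P_s the projection onto l^2({s+1,s+2,...}).\<close>
definition Qsig :: "(real \<Rightarrow> real) \<Rightarrow> real \<Rightarrow> real \<Rightarrow> real" where
  "Qsig \<sigma> L s = fredholm_det (Ksig \<sigma> L) {a \<in> Zp. s < a}"

definition Q0 :: "(real \<Rightarrow> real) \<Rightarrow> real \<Rightarrow> real" where
  "Q0 \<sigma> s = (\<Prod>i. 1 - \<sigma> (- (real i + 1) - s))"

end

(* Write D for the diagonal matrix with entries d_i = 1 - sigma(-s-1-i), i >= 0, and K_L for the
   kernel on {s+1, s+2, ...}. At L = 0 one has 1 - K_0 = D, so that
   det (1 - K_L) = (prod d_i) * det (1 - M) with M = D^(-1) (K_L - K_0).
   Expand det (1 - M) into principal minors. The entry M_ij is O(L^2) on the diagonal and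
   O(L^(min(|i-j|,2))) off it, with a summable majorant coming from |J_n(2L)| <= C (L/2)^|n|, so modulo
   L^4 only the trace and the products M_(i,i+1) M_(i+1,i) survive (a 3-cycle cannot consist
   of three unit steps). Their L^2-coefficients telescope to d_(-1)/d_0 - 1. All bounds are uniform
   over finite truncations {0..N-1}, and the Fredholm series is the limit of these
   truncated determinants. *)
theory Submission
  imports Defs "HOL-Combinatorics.Multiset_Permutations"
begin

text \<open>Trace-class control is expressed by a single number: a bound on the sum of all entries
  of a nonnegative majorant of the kernel. It is finite because the values of sigma attached to k >=
  0 are summable, while for k < 0 every index i >= 0 lies at distance i + |k| from k and the Bessel
  factors decay geometrically. A minor is at most a permanent of the majorant, hence at most a
  product of row sums; summed over index sets of one size this gives powers, summed over all index
  sets an exponential, in both cases independent of the truncation. The factor prod d_i is pulled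
  out of the finite determinants, by scaling rows, and the limit is taken afterwards. Dividing by
  d_i must be uniform in i: all d_i are positive because their product is, and they tend to 1
  because sigma is summable. The same limit disposes of the boundary ratio d_(N+1) / d_N which the
  telescoping sum leaves at the cut-off.\<close>

section \<open>Fredholm determinants as limits of finite determinants\<close>

(* Indexing by permutations of a finite set instead of matrices makes the expansion of det(1 - K)
   into principal minors a regrouping of permutations by a set T containing their support. *)
definition leibniz_det :: "'a set \<Rightarrow> ('a \<Rightarrow> 'a \<Rightarrow> real) \<Rightarrow> real" where
  "leibniz_det T A = (\<Sum>p | p permutes T. of_int (sign p) * (\<Prod>i\<in>T. A i (p i)))"

text \<open>The permanent: with a majorant as entries it bounds a minor irrespective of signs and is
  monotone in the entries.\<close>

definition leibniz_perm :: "'a set \<Rightarrow> ('a \<Rightarrow> 'a \<Rightarrow> real) \<Rightarrow> real" where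
  "leibniz_perm T A = (\<Sum>p | p permutes T. (\<Prod>i\<in>T. A i (p i)))"

lemma abs_leibniz_det_le:
  assumes "\<And>i j. i \<in> T \<Longrightarrow> j \<in> T \<Longrightarrow> \<bar>A i j\<bar> \<le> h i j"
  shows "\<bar>leibniz_det T A\<bar> \<le> leibniz_perm T h"
proof -
  have "\<bar>leibniz_det T A\<bar> \<le> (\<Sum>p | p permutes T. \<bar>of_int (sign p) * (\<Prod>i\<in>T. A i (p i))\<bar>)"
    unfolding leibniz_det_def by (rule sum_abs)
  also have "\<dots> = (\<Sum>p | p permutes T. (\<Prod>i\<in>T. \<bar>A i (p i)\<bar>))"
    by (intro sum.cong refl) (simp add: abs_mult abs_prod sign_def)
  also have "\<dots> \<le> leibniz_perm T h"
    unfolding leibniz_perm_def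
    by (intro sum_mono prod_mono) (auto intro!: assms simp: permutes_in_image)
  finally show ?thesis .
qed

text \<open>Permutations of \<open>T\<close> are among the maps from \<open>T\<close> to
  \<open>T\<close>; with nonnegative terms the sum may be enlarged to all maps, and that sum factors
  over rows. Restriction to \<open>T\<close> is needed since a permutation is the identity off
  \<open>T\<close>, while members of \<open>PiE\<close> are undefined there.\<close>

lemma leibniz_perm_le_prod_row_sums:
  assumes "finite T" and nn: "\<And>i j. i \<in> T \<Longrightarrow> j \<in> T \<Longrightarrow> h i j \<ge> 0"
  shows "leibniz_perm T h \<le> (\<Prod>i\<in>T. \<Sum>j\<in>T. h i j)"
proof -
  have inj: "inj_on (\<lambda>p. restrict p T) {p. p permutes T}"
  proof (rule inj_onI)
    fix p q assume pq: "p \<in> {p. p permutes T}" "q \<in> {p. p permutes T}" "restrict p T = restrict q T"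
    show "p = q"
    proof
      fix x show "p x = q x"
        using pq by (cases "x \<in> T") (auto simp: permutes_not_in dest: fun_cong[of _ _ x])
    qed
  qed
  have "leibniz_perm T h = (\<Sum>p | p permutes T. (\<Prod>i\<in>T. h i (restrict p T i)))"
    unfolding leibniz_perm_def by (intro sum.cong prod.cong) auto
  also have "\<dots> = (\<Sum>g\<in>(\<lambda>p. restrict p T) ` {p. p permutes T}. \<Prod>i\<in>T. h i (g i))"
    by (subst sum.reindex[OF inj]) simp
  also have "\<dots> \<le> (\<Sum>g\<in>PiE T (\<lambda>_. T). \<Prod>i\<in>T. h i (g i))"
  proof (rule sum_mono2)
    show "finite (PiE T (\<lambda>_. T))" using assms by (intro finite_PiE) auto
    show "(\<lambda>p. restrict p T) ` {p. p permutes T} \<subseteq> PiE T (\<lambda>_. T)"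
      by (auto simp: permutes_in_image)
  qed (auto intro!: prod_nonneg nn)
  also have "\<dots> = (\<Prod>i\<in>T. \<Sum>j\<in>T. h i j)"
    by (rule prod_sum_PiE[symmetric]) (use assms in auto)
  finally show ?thesis .
qed

lemma leibniz_perm_nonneg:
  assumes "\<And>i j. i \<in> T \<Longrightarrow> j \<in> T \<Longrightarrow> h i j \<ge> 0"
  shows "leibniz_perm T h \<ge> 0"
  unfolding leibniz_perm_def
  by (intro sum_nonneg prod_nonneg) (auto intro!: assms simp: permutes_in_image)

text \<open>With every row sum r_i enlarged to run over \<open>U\<close>, the sum over subsets is
  the expansion of prod (1 + r_i), and 1 + r <= exp r. Only the total of the entries enters, which
  later makes the error uniform in the truncation.\<close>

lemma sum_leibniz_perm_le_exp:
  assumes "finite U" and nn: "\<And>i j. h i j \<ge> 0"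
  shows "(\<Sum>T\<in>Pow U. leibniz_perm T h) \<le> exp (\<Sum>i\<in>U. \<Sum>j\<in>U. h i j)"
proof -
  have "(\<Sum>T\<in>Pow U. leibniz_perm T h) \<le> (\<Sum>T\<in>Pow U. (\<Prod>i\<in>T. \<Sum>j\<in>U. h i j) * (\<Prod>i\<in>U-T. 1))"
  proof (rule sum_mono)
    fix T assume T: "T \<in> Pow U"
    then have fT: "finite T" using assms(1) finite_subset by auto
    have "leibniz_perm T h \<le> (\<Prod>i\<in>T. \<Sum>j\<in>T. h i j)"
      using leibniz_perm_le_prod_row_sums[OF fT] nn by blast
    also have "\<dots> \<le> (\<Prod>i\<in>T. \<Sum>j\<in>U. h i j)"
      using T assms by (intro prod_mono conjI sum_nonneg sum_mono2) auto
    finally show "leibniz_perm T h \<le> (\<Prod>i\<in>T. \<Sum>j\<in>U. h i j) * (\<Prod>i\<in>U-T. 1)" by simp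
  qed
  also have "\<dots> = (\<Prod>i\<in>U. (\<Sum>j\<in>U. h i j) + 1)"
    by (rule prod_add[symmetric]) fact
  also have "\<dots> \<le> (\<Prod>i\<in>U. exp (\<Sum>j\<in>U. h i j))"
    using nn by (intro prod_mono) (auto intro!: add_nonneg_nonneg sum_nonneg simp: add.commute)
  also have "\<dots> = exp (\<Sum>i\<in>U. \<Sum>j\<in>U. h i j)"
    using assms by (simp add: exp_sum)
  finally show ?thesis .
qed

text \<open>Expanding the product of differences selects the set \<open>T\<close> of rows that use
  \<open>K\<close>; the Kronecker deltas on \<open>U - T\<close> annihilate every permutation moving
  a point outside \<open>T\<close>, so only permutations of \<open>T\<close> remain.\<close>

lemma leibniz_det_one_minus:
  assumes "finite U"
  shows "leibniz_det U (\<lambda>i j. of_bool (i = j) - K i j) = (\<Sum>T\<in>Pow U. (-1) ^ card T * leibniz_det T K)"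
proof -
  have "leibniz_det U (\<lambda>i j. of_bool (i = j) - K i j) =
     (\<Sum>p | p permutes U. \<Sum>T\<in>Pow U. of_int (sign p) *
       ((-1) ^ card T * (\<Prod>i\<in>T. K i (p i)) * (\<Prod>i\<in>U-T. of_bool (i = p i))))"
    unfolding leibniz_det_def by (simp add: prod_diff_conv_sum[OF assms] sum_distrib_left)
  also have "\<dots> = (\<Sum>T\<in>Pow U. \<Sum>p | p permutes U. of_int (sign p) *
       ((-1) ^ card T * (\<Prod>i\<in>T. K i (p i)) * (\<Prod>i\<in>U-T. of_bool (i = p i))))"
    by (rule sum.swap)
  also have "\<dots> = (\<Sum>T\<in>Pow U. (-1) ^ card T * leibniz_det T K)"
  proof (rule sum.cong[OF refl])
    fix T assume T: "T \<in> Pow U"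
    have "(\<Sum>p | p permutes U. of_int (sign p) *
       ((-1) ^ card T * (\<Prod>i\<in>T. K i (p i)) * (\<Prod>i\<in>U-T. of_bool (i = p i)))) =
       (\<Sum>p | p permutes T. of_int (sign p) *
       ((-1) ^ card T * (\<Prod>i\<in>T. K i (p i)) * (\<Prod>i\<in>U-T. of_bool (i = p i))))"
    proof (rule sum.mono_neutral_right)
      show "finite {p. p permutes U}" by (rule finite_permutations[OF assms])
      show "{p. p permutes T} \<subseteq> {p. p permutes U}" using T by (auto intro: permutes_subset)
      show "\<forall>p\<in>{p. p permutes U} - {p. p permutes T}. of_int (sign p) *
       ((-1) ^ card T * (\<Prod>i\<in>T. K i (p i)) * (\<Prod>i\<in>U-T. of_bool (i = p i))) = 0"
      proof
        fix p assume p: "p \<in> {p. p permutes U} - {p. p permutes T}"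
        have "\<exists>i\<in>U-T. p i \<noteq> i"
        proof (rule ccontr)
          assume "\<not> ?thesis"
          then have "p permutes T" using p permutes_superset[of p U T] by auto
          with p show False by auto
        qed
        then obtain i where i: "i \<in> U - T" "p i \<noteq> i" by auto
        then have "(\<Prod>i\<in>U-T. of_bool (i = p i)) = (0::real)"
          using assms by (intro prod_zero bexI[of _ i]) auto
        then show "of_int (sign p) *
           ((-1) ^ card T * (\<Prod>i\<in>T. K i (p i)) * (\<Prod>i\<in>U-T. of_bool (i = p i))) = 0" by simp
      qed
    qed
    also have "\<dots> = (\<Sum>p | p permutes T. of_int (sign p) * ((-1) ^ card T * (\<Prod>i\<in>T. K i (p i))))"
    proof (rule sum.cong[OF refl])
      fix p assume "p \<in> {p. p permutes T}"
      then have "(\<Prod>i\<in>U-T. of_bool (i = p i)) = (1::real)"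
        by (intro prod.neutral) (auto simp: permutes_not_in)
      then show "of_int (sign p) * ((-1) ^ card T * (\<Prod>i\<in>T. K i (p i)) * (\<Prod>i\<in>U-T. of_bool (i = p i)))
        = of_int (sign p) * ((-1) ^ card T * (\<Prod>i\<in>T. K i (p i)))" by simp
    qed
    also have "\<dots> = (-1) ^ card T * leibniz_det T K"
      unfolding leibniz_det_def by (simp add: sum_distrib_left mult_ac)
    finally show "(\<Sum>p | p permutes U. of_int (sign p) *
       ((-1) ^ card T * (\<Prod>i\<in>T. K i (p i)) * (\<Prod>i\<in>U-T. of_bool (i = p i)))) =
       (-1) ^ card T * leibniz_det T K" .
  qed
  finally show ?thesis .
qed

lemma leibniz_det_scale_rows:
  "leibniz_det U (\<lambda>i j. d i * A i j) = (\<Prod>i\<in>U. d i) * leibniz_det U A"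
  unfolding leibniz_det_def by (simp add: prod.distrib sum_distrib_left mult_ac)

section \<open>Fredholm's series on finite index sets and its limit\<close>

lemma det_mat_of_distinct_list:
  assumes "distinct xs"
  shows "Determinant.det (mat (length xs) (length xs) (\<lambda>(i, j). K (xs ! i) (xs ! j)))
    = leibniz_det (set xs) K"
proof -
  define n where "n = length xs"
  define F where "F = map_permutation {0..<n} ((!) xs)"
  have b: "bij_betw ((!) xs) {0..<n} (set xs)"
    using assms bij_betw_nth[of xs "{0..<n}" "set xs"] by (simp add: n_def atLeast0LessThan)
  then have inj: "inj_on ((!) xs) {0..<n}" and im: "(!) xs ` {0..<n} = set xs"
    by (auto simp: bij_betw_def)
  \<comment> \<open>\<open>bij_betw_permutations\<close> transports permutations by an explicit
    formula; identifying it with \<open>map_permutation\<close> makes the invariance of the sign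
    available.\<close>
  have "(\<lambda>\<pi> x. if x \<in> set xs then xs ! (\<pi> (inv_into {0..<n} ((!) xs) x)) else x) = F"
    unfolding F_def map_permutation_def im by (auto simp: restrict_id_def fun_eq_iff)
  then have bF: "bij_betw F {p. p permutes {0..<n}} {p. p permutes set xs}"
    using bij_betw_permutations[OF b] by simp
  have "leibniz_det (set xs) K =
     (\<Sum>p | p permutes {0..<n}. of_int (sign (F p)) * (\<Prod>x\<in>set xs. K x (F p x)))"
    unfolding leibniz_det_def by (rule sum.reindex_bij_betw[OF bF, symmetric])
  also have "\<dots> = (\<Sum>p | p permutes {0..<n}. of_int (sign p) * (\<Prod>i=0..<n. K (xs!i) (xs!(p i))))"
  proof (rule sum.cong[OF refl])
    fix p assume p: "p \<in> {p. p permutes {0..<n}}"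
    have "sign (F p) = sign p"
      unfolding F_def using p by (intro sign_map_permutation inj) auto
    moreover have "(\<Prod>x\<in>set xs. K x (F p x)) = (\<Prod>i=0..<n. K (xs!i) (F p (xs!i)))"
      by (rule prod.reindex_bij_betw[OF b, symmetric])
    moreover have "\<dots> = (\<Prod>i=0..<n. K (xs!i) (xs!(p i)))"
      unfolding F_def by (intro prod.cong refl) (simp add: map_permutation_apply[OF inj])
    ultimately show "of_int (sign (F p)) * (\<Prod>x\<in>set xs. K x (F p x)) =
       of_int (sign p) * (\<Prod>i=0..<n. K (xs!i) (xs!(p i)))" by simp
  qed
  also have "\<dots> = Determinant.det (mat n n (\<lambda>(i, j). K (xs ! i) (xs ! j)))"
    by (subst det_def'[OF mat_carrier]) (intro sum.cong prod.cong arg_cong2[of _ _ _ _ "(*)"]; auto simp: permutes_in_image)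
  finally show ?thesis unfolding n_def by simp
qed

lemma det_mat_of_nondistinct_list:
  assumes "\<not> distinct xs"
  shows "Determinant.det (mat (length xs) (length xs) (\<lambda>(i, j). K (xs ! i) (xs ! j))) = (0::real)"
proof -
  from assms obtain i j where ij: "i < length xs" "j < length xs" "i \<noteq> j" "xs ! i = xs ! j"
    by (auto simp: distinct_conv_nth)
  show ?thesis
    by (rule det_identical_rows[OF mat_carrier ij(3,1,2)]) (use ij in \<open>auto intro!: eq_vecI\<close>)
qed

text \<open>A repeated entry gives two equal rows, hence determinant zero; each
  \<open>n\<close>-element subset is enumerated by \<open>fact n\<close> distinct lists with the
  same minor. This cancels the \<open>1 / fact n\<close> of Fredholm's series.\<close>

lemma sum_det_lists:
  fixes K :: "'a \<Rightarrow> 'a \<Rightarrow> real"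
  assumes "finite U"
  shows "(\<Sum>xs | length xs = n \<and> set xs \<subseteq> U.
      Determinant.det (mat n n (\<lambda>(i, j). K (xs ! i) (xs ! j))))
    = fact n * (\<Sum>T | T \<subseteq> U \<and> card T = n. leibniz_det T K)"
proof -
  have finL: "finite {xs. length xs = n \<and> set xs \<subseteq> U}"
    using finite_lists_length_eq[OF assms, of n] by (simp add: conj_commute)
  have finL': "finite {xs. length xs = n \<and> set xs \<subseteq> U \<and> distinct xs}"
    by (rule finite_subset[OF _ finL]) auto
  have finT: "finite {T. T \<subseteq> U \<and> card T = n}"
    by (rule finite_subset[of _ "Pow U"]) (use assms in auto)
  have "(\<Sum>xs | length xs = n \<and> set xs \<subseteq> U.
      Determinant.det (mat n n (\<lambda>(i, j). K (xs ! i) (xs ! j))))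
    = (\<Sum>xs | length xs = n \<and> set xs \<subseteq> U \<and> distinct xs. leibniz_det (set xs) K)"
  proof (rule sum.mono_neutral_cong_right[OF finL])
    show "\<forall>xs\<in>{xs. length xs = n \<and> set xs \<subseteq> U} - {xs. length xs = n \<and> set xs \<subseteq> U \<and> distinct xs}.
      Determinant.det (mat n n (\<lambda>(i, j). K (xs ! i) (xs ! j))) = 0"
      using det_mat_of_nondistinct_list by blast
  qed (auto simp: det_mat_of_distinct_list)
  also have "\<dots> = (\<Sum>T | T \<subseteq> U \<and> card T = n.
      \<Sum>xs | xs \<in> {xs. length xs = n \<and> set xs \<subseteq> U \<and> distinct xs} \<and> set xs = T. leibniz_det (set xs) K)"
    by (rule sum.group[OF finL' finT, symmetric]) (auto simp: distinct_card)
  also have "\<dots> = (\<Sum>T | T \<subseteq> U \<and> card T = n. fact n * leibniz_det T K)"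
  proof (rule sum.cong[OF refl])
    fix T assume T: "T \<in> {T. T \<subseteq> U \<and> card T = n}"
    then have fT: "finite T" using assms finite_subset by auto
    have "{xs. xs \<in> {xs. length xs = n \<and> set xs \<subseteq> U \<and> distinct xs} \<and> set xs = T} = permutations_of_set T"
      using T by (auto simp: permutations_of_set_def distinct_card)
    moreover have "(\<Sum>xs\<in>permutations_of_set T. leibniz_det (set xs) K) = (\<Sum>xs\<in>permutations_of_set T. leibniz_det T K)"
      by (intro sum.cong) (auto simp: permutations_of_set_def)
    ultimately show "(\<Sum>xs | xs \<in> {xs. length xs = n \<and> set xs \<subseteq> U \<and> distinct xs} \<and> set xs = T. leibniz_det (set xs) K)
       = fact n * leibniz_det T K"
      using T fT by simp
  qed
  finally show ?thesis by (simp add: sum_distrib_left)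
qed

text \<open>Grouping the principal minors by size gives Fredholm's series, which stops at
  \<open>card U\<close> because there are no larger subsets.\<close>

lemma leibniz_det_one_minus_eq_fredholm_sums:
  fixes K :: "'a \<Rightarrow> 'a \<Rightarrow> real"
  assumes "finite U"
  shows "leibniz_det U (\<lambda>i j. of_bool (i = j) - K i j) =
    (\<Sum>n. (-1) ^ n / fact n * (\<Sum>xs | length xs = n \<and> set xs \<subseteq> U.
      Determinant.det (mat n n (\<lambda>(i, j). K (xs ! i) (xs ! j)))))"
proof -
  have "leibniz_det U (\<lambda>i j. of_bool (i = j) - K i j) = (\<Sum>T\<in>Pow U. (-1) ^ card T * leibniz_det T K)"
    by (rule leibniz_det_one_minus[OF assms])
  also have "\<dots> = (\<Sum>n\<in>{..card U}. \<Sum>T | T \<in> Pow U \<and> card T = n. (-1) ^ card T * leibniz_det T K)"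
    by (rule sum.group[symmetric]) (use assms in \<open>auto intro: card_mono\<close>)
  also have "\<dots> = (\<Sum>n\<in>{..card U}. (-1) ^ n * (\<Sum>T | T \<subseteq> U \<and> card T = n. leibniz_det T K))"
    unfolding sum_distrib_left by (intro sum.cong) auto
  also have "\<dots> = (\<Sum>n\<in>{..card U}. (-1) ^ n / fact n * (\<Sum>xs | length xs = n \<and> set xs \<subseteq> U.
      Determinant.det (mat n n (\<lambda>(i, j). K (xs ! i) (xs ! j)))))"
    by (simp add: sum_det_lists[OF assms])
  also have "\<dots> = (\<Sum>n. (-1) ^ n / fact n * (\<Sum>xs | length xs = n \<and> set xs \<subseteq> U.
      Determinant.det (mat n n (\<lambda>(i, j). K (xs ! i) (xs ! j)))))"
  proof (rule suminf_finite[symmetric])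
    fix n assume n: "n \<notin> {..card U}"
    have "{T. T \<subseteq> U \<and> card T = n} = {}" using n card_mono[OF assms] by auto
    then show "(-1) ^ n / fact n * (\<Sum>xs | length xs = n \<and> set xs \<subseteq> U.
      Determinant.det (mat n n (\<lambda>(i, j). K (xs ! i) (xs ! j)))) = 0"
      by (simp add: sum_det_lists[OF assms] del: Collect_empty_eq)
  qed simp
  finally show ?thesis .
qed

text \<open>Row sums over the fixed set \<open>U\<close>, instead of over the entries of the list,
  make the bound a product over list positions; its sum over all lists is then an
  \<open>n\<close>-th power.\<close>

lemma abs_det_list_le:
  fixes K :: "'a \<Rightarrow> 'a \<Rightarrow> real"
  assumes U: "finite U" "set xs \<subseteq> U" and h: "\<And>i j. \<bar>K i j\<bar> \<le> h i j"
  shows "\<bar>Determinant.det (mat (length xs) (length xs) (\<lambda>(i, j). K (xs ! i) (xs ! j)))\<bar>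
    \<le> (\<Prod>x<length xs. \<Sum>j\<in>U. h (xs ! x) j)"
proof -
  have nn: "h i j \<ge> 0" for i j using h[of i j] by linarith
  show ?thesis
  proof (cases "distinct xs")
    case True
    have "\<bar>leibniz_det (set xs) K\<bar> \<le> leibniz_perm (set xs) h"
      by (rule abs_leibniz_det_le) (rule h)
    also have "\<dots> \<le> (\<Prod>i\<in>set xs. \<Sum>j\<in>set xs. h i j)"
      by (rule leibniz_perm_le_prod_row_sums) (auto intro: nn)
    also have "\<dots> \<le> (\<Prod>i\<in>set xs. \<Sum>j\<in>U. h i j)"
      using U nn by (intro prod_mono conjI sum_nonneg sum_mono2) auto
    also have "\<dots> = (\<Prod>x<length xs. \<Sum>j\<in>U. h (xs ! x) j)"
      by (rule prod.reindex_bij_betw[symmetric, OF bij_betw_nth[OF True]]) auto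
    finally show ?thesis by (simp add: det_mat_of_distinct_list[OF True])
  qed (simp add: det_mat_of_nondistinct_list nn prod_nonneg sum_nonneg)
qed

lemma sum_prod_lists:
  fixes f :: "'a \<Rightarrow> real"
  assumes "finite U"
  shows "(\<Sum>xs | length xs = n \<and> set xs \<subseteq> U. \<Prod>x<n. f (xs ! x)) = (\<Sum>x\<in>U. f x) ^ n"
proof (induction n)
  case 0
  have "{xs. length xs = 0 \<and> set xs \<subseteq> U} = {[]}" by auto
  then show ?case by simp
next
  case (Suc n)
  have E: "{xs. length xs = Suc n \<and> set xs \<subseteq> U} =
    (\<lambda>(x, xs). x # xs) ` (U \<times> {xs. length xs = n \<and> set xs \<subseteq> U})"
    by (auto simp: image_iff length_Suc_conv)
  have inj: "inj_on (\<lambda>(x, xs). x # xs) (U \<times> {xs. length xs = n \<and> set xs \<subseteq> U})"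
    by (auto simp: inj_on_def)
  have "(\<Sum>xs | length xs = Suc n \<and> set xs \<subseteq> U. \<Prod>x<Suc n. f (xs ! x)) =
     (\<Sum>(x, xs)\<in>U \<times> {xs. length xs = n \<and> set xs \<subseteq> U}. f x * (\<Prod>i<n. f (xs ! i)))"
    unfolding E by (subst sum.reindex[OF inj]) (simp add: prod.lessThan_Suc_shift case_prod_beta del: prod.lessThan_Suc)
  also have "\<dots> = (\<Sum>x\<in>U. f x) * (\<Sum>x\<in>U. f x) ^ n"
    by (simp add: sum.cartesian_product[symmetric] Suc sum_distrib_left[symmetric] sum_distrib_right[symmetric])
  finally show ?case by simp
qed

lemma sum_abs_det_lists_le:
  fixes K :: "'a \<Rightarrow> 'a \<Rightarrow> real"
  assumes U: "finite U" and h: "\<And>i j. \<bar>K i j\<bar> \<le> h i j"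
  shows "(\<Sum>xs | length xs = n \<and> set xs \<subseteq> U.
      \<bar>Determinant.det (mat n n (\<lambda>(i, j). K (xs ! i) (xs ! j)))\<bar>) \<le> (\<Sum>i\<in>U. \<Sum>j\<in>U. h i j) ^ n"
proof -
  have "(\<Sum>xs | length xs = n \<and> set xs \<subseteq> U.
      \<bar>Determinant.det (mat n n (\<lambda>(i, j). K (xs ! i) (xs ! j)))\<bar>)
    \<le> (\<Sum>xs | length xs = n \<and> set xs \<subseteq> U. \<Prod>x<n. \<Sum>j\<in>U. h (xs ! x) j)"
    using abs_det_list_le[OF U _ h] by (intro sum_mono) auto
  then show ?thesis by (simp add: sum_prod_lists[OF U, of "\<lambda>i. \<Sum>j\<in>U. h i j" n])
qed

text \<open>For fixed \<open>n\<close> the lists over \<open>{..<N}\<close> exhaust all lists of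
  length \<open>n\<close>; the bound \<open>R ^ n / fact n\<close>, free of \<open>N\<close>, then
  allows Tannery's theorem for the outer series.\<close>

lemma fredholm_det_limit:
  fixes K :: "nat \<Rightarrow> nat \<Rightarrow> real"
  assumes h: "\<And>i j. \<bar>K i j\<bar> \<le> h i j" and R: "\<And>N. (\<Sum>i<N. \<Sum>j<N. h i j) \<le> R"
  shows "(\<lambda>N. leibniz_det {..<N} (\<lambda>i j. of_bool (i = j) - K i j)) \<longlonglongrightarrow> fredholm_det K UNIV"
proof -
  define D where "D n xs = Determinant.det (mat n n (\<lambda>(i, j). K (xs ! i) (xs ! j)))" for n xs
  define L where "L n N = {xs::nat list. length xs = n \<and> set xs \<subseteq> {..<N}}" for n N
  have nn: "h i j \<ge> 0" for i j using h[of i j] by linarith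
  have R0: "R \<ge> 0" using R[of 0] by simp
  have finL: "finite (L n N)" for n N
    using finite_lists_length_eq[of "{..<N}" n] by (simp add: conj_commute L_def)
  have bound: "(\<Sum>xs\<in>L n N. \<bar>D n xs\<bar>) \<le> R ^ n" for n N
  proof -
    have "(\<Sum>xs\<in>L n N. \<bar>D n xs\<bar>) \<le> (\<Sum>i<N. \<Sum>j<N. h i j) ^ n"
      using sum_abs_det_lists_le[of "{..<N}" K h n] h unfolding L_def D_def by simp
    also have "\<dots> \<le> R ^ n" by (intro power_mono R sum_nonneg nn)
    finally show ?thesis .
  qed
  have sub: "\<exists>N. F \<subseteq> L n N" if F: "finite F" "F \<subseteq> {xs. length xs = n}" for n F
  proof -
    have "finite (\<Union>xs\<in>F. set xs)" using F by auto
    then obtain N where "(\<Union>xs\<in>F. set xs) \<subseteq> {..<N}" using finite_nat_iff_bounded by blast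
    then show ?thesis using F by (intro exI[of _ N]) (auto simp: L_def)
  qed
  \<comment> \<open>Every finite set of lists lies in some \<open>L n N\<close>, so
    \<open>bound\<close> controls all finite partial sums of absolute values.\<close>
  have summ: "D n summable_on {xs. length xs = n}" for n
  proof (rule abs_summable_summable, rule nonneg_bdd_above_summable_on)
    show "bdd_above (sum (\<lambda>x. norm (D n x)) ` {F. F \<subseteq> {xs. length xs = n} \<and> finite F})"
    proof (rule bdd_aboveI2[where M = "R ^ n"])
      fix F assume F: "F \<in> {F. F \<subseteq> {xs::nat list. length xs = n} \<and> finite F}"
      then obtain N where "F \<subseteq> L n N" using sub by blast
      then have "(\<Sum>x\<in>F. norm (D n x)) \<le> (\<Sum>xs\<in>L n N. \<bar>D n xs\<bar>)"
        using finL by (simp add: sum_mono2)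
      with bound[of n N] show "(\<Sum>x\<in>F. norm (D n x)) \<le> R ^ n" by linarith
    qed
  qed auto
  have lim: "(\<lambda>N. \<Sum>xs\<in>L n N. D n xs) \<longlonglongrightarrow> infsum (D n) {xs. length xs = n}" for n
  proof -
    have "filterlim (L n) (finite_subsets_at_top {xs. length xs = n}) sequentially"
      unfolding filterlim_finite_subsets_at_top
    proof (intro allI impI)
      fix F assume "finite F \<and> F \<subseteq> {xs::nat list. length xs = n}"
      then obtain N where N: "F \<subseteq> L n N" using sub by blast
      show "\<forall>\<^sub>F y in sequentially. finite (L n y) \<and> F \<subseteq> L n y \<and> L n y \<subseteq> {xs. length xs = n}"
        using eventually_ge_at_top[of N]
      proof eventually_elim
        case (elim y)
        then have "L n N \<subseteq> L n y" by (auto simp: L_def)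
        then show ?case using N finL by (auto simp: L_def)
      qed
    qed
    then show ?thesis by (rule filterlim_compose[OF infsum_tendsto[OF summ]])
  qed
  have "(\<lambda>N. \<Sum>n. (-1) ^ n / fact n * (\<Sum>xs\<in>L n N. D n xs)) \<longlonglongrightarrow>
      (\<Sum>n. (-1) ^ n / fact n * infsum (D n) {xs. length xs = n})"
  proof (rule conjunct2[OF conjunct2[OF tannerys_theorem[where M = "\<lambda>n. R ^ n / fact n"]]])
    show "(\<lambda>N. (-1) ^ n / fact n * (\<Sum>xs\<in>L n N. D n xs)) \<longlonglongrightarrow>
      (-1) ^ n / fact n * infsum (D n) {xs. length xs = n}" for n
      by (intro tendsto_intros lim)
    have "norm ((-1) ^ n / fact n * (\<Sum>xs\<in>L n N. D n xs)) \<le> R ^ n / fact n" for n N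
    proof -
      have "\<bar>\<Sum>xs\<in>L n N. D n xs\<bar> \<le> R ^ n" using bound[of n N] sum_abs[of "D n" "L n N"] by linarith
      then show ?thesis by (simp add: abs_mult divide_right_mono)
    qed
    then show "\<forall>\<^sub>F (n, N) in sequentially \<times>\<^sub>F sequentially.
       norm ((-1) ^ n / fact n * (\<Sum>xs\<in>L n N. D n xs)) \<le> R ^ n / fact n"
      by (intro always_eventually) auto
    show "summable (\<lambda>n. R ^ n / fact n)"
      using summable_exp_generic[of R] by (simp add: divide_inverse mult.commute)
  qed simp
  then show ?thesis
    unfolding leibniz_det_one_minus_eq_fredholm_sums[OF finite_lessThan] fredholm_det_def
    by (simp add: L_def D_def[abs_def])
qed

lemma fredholm_det_image:
  assumes "inj_on f A"
  shows "fredholm_det K (f ` A) = fredholm_det (\<lambda>i j. K (f i) (f j)) A"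
proof -
  have "(\<Sum>\<^sub>\<infinity>xs\<in>{xs. length xs = n \<and> set xs \<subseteq> f ` A}. Determinant.det (mat n n (\<lambda>(i, j). K (xs ! i) (xs ! j))))
     = (\<Sum>\<^sub>\<infinity>xs\<in>{xs. length xs = n \<and> set xs \<subseteq> A}. Determinant.det (mat n n (\<lambda>(i, j). K (f (xs ! i)) (f (xs ! j)))))" for n
  proof -
    have E: "{xs. length xs = n \<and> set xs \<subseteq> f ` A} = map f ` {xs. length xs = n \<and> set xs \<subseteq> A}"
      using lists_image[of f A] by (auto simp: lists_eq_set image_iff set_eq_iff)
    have inj: "inj_on (map f) {xs. length xs = n \<and> set xs \<subseteq> A}"
      by (rule inj_on_subset[OF inj_on_map_lists[OF assms]]) auto
    show ?thesis unfolding E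
      by (subst infsum_reindex[OF inj])
         (auto simp: o_def intro!: infsum_cong arg_cong[where f = Determinant.det] eq_matI)
  qed
  then show ?thesis unfolding fredholm_det_def by simp
qed

section \<open>Bessel functions and the kernel near zero\<close>

text \<open>The factor \<open>1 / fact n\<close> in a Bessel bound is traded for this weight. It is
  summable over orders even at \<open>L = 1\<close>, so the powers of \<open>L\<close> stay free to
  measure smallness.\<close>

definition geo :: "int \<Rightarrow> real" where
  "geo n = (1/2) ^ nat \<bar>n\<bar>"

(* Entry (i, j) of K_L - K_0 is O(L ^ band (i - j)): Bessel orders give |i - j| off the diagonal, capped
   at 2 because nothing beyond L^2 is needed. *)
definition band :: "int \<Rightarrow> nat" where
  "band k = (if \<bar>k\<bar> = 1 then 1 else 2)"

lemma geo_nonneg [simp]: "geo n \<ge> 0" and geo_le_1 [simp]: "geo n \<le> 1"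
  by (auto simp: geo_def power_le_one)

lemma geo_minus [simp]: "geo (- n) = geo n"
  by (simp add: geo_def)

lemma inverse_fact_le_geo: "1 / fact n \<le> 2 * geo (int n)"
proof (induction n)
  case (Suc n)
  show ?case
  proof (cases "n = 0")
    case False
    have "1 / fact (Suc n) = (1 / fact n) / (real n + 1)" by (simp add: field_simps)
    also have "\<dots> \<le> (2 * geo (int n)) / 2"
      using False Suc by (intro frac_le) auto
    finally show ?thesis by (simp add: geo_def nat_add_distrib)
  qed (simp add: geo_def)
qed (simp add: geo_def)

text \<open>The tail is dominated by the exponential series:
  \<open>fact (m + k) * fact (m + k + n)\<close> is at least \<open>fact m * fact n\<close>, and for
  \<open>L \<le> 1\<close> the lowest power of \<open>L\<close> is the largest. The constant 3
  bounds e.\<close>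

lemma BesselJ_truncate:
  assumes L: "0 \<le> L" "L \<le> 1"
  shows "\<bar>BesselJ (int n) (2 * L) - (\<Sum>m<k. (-1) ^ m / (fact m * fact (m + n)) * L ^ (2 * m + n))\<bar>
    \<le> 3 * L ^ (2 * k + n) / fact n"
proof -
  define a where "a m = (-1) ^ m / (fact m * fact (m + n)) * L ^ (2 * m + n)" for m
  have bd: "\<bar>a (m + k)\<bar> \<le> L ^ (2 * k + n) / fact n * (inverse (fact m) * 1 ^ m)" for m k
  proof -
    have "\<bar>a (m + k)\<bar> = 1 / (fact (m + k) * fact (m + k + n)) * L ^ (2 * (m + k) + n)"
      using L by (simp add: a_def abs_mult)
    also have "\<dots> \<le> 1 / (fact m * fact n) * L ^ (2 * k + n)"
      using L by (intro mult_mono frac_le mult_mono fact_mono power_decreasing) auto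
    finally show ?thesis by (simp add: field_simps)
  qed
  have se: "summable (\<lambda>m. inverse (fact m) * 1 ^ m :: real)" by (rule summable_exp)
  have sk: "summable (\<lambda>m. \<bar>a (m + k)\<bar>)" for k
    by (rule summable_comparison_test'[OF summable_mult[OF se, of "L ^ (2 * k + n) / fact n"], of 0])
       (use bd[of _ k] in auto)
  have s: "summable a" using sk[of 0] by (simp add: summable_rabs_cancel)
  have e: "(\<Sum>m. inverse (fact m) * 1 ^ m :: real) \<le> 3"
    using exp_le by (simp add: exp_def divide_inverse)
  have "BesselJ (int n) (2 * L) - (\<Sum>m<k. a m) = (\<Sum>m. a (m + k))"
    unfolding BesselJ_def using suminf_minus_initial_segment[OF s, of k] by (simp add: a_def[abs_def])
  then have "\<bar>BesselJ (int n) (2 * L) - (\<Sum>m<k. a m)\<bar> \<le> (\<Sum>m. \<bar>a (m + k)\<bar>)"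
    using summable_rabs[OF sk[of k]] by simp
  also have "\<dots> \<le> (\<Sum>m. L ^ (2 * k + n) / fact n * (inverse (fact m) * 1 ^ m))"
    by (intro suminf_le bd sk summable_mult se)
  also have "\<dots> = L ^ (2 * k + n) / fact n * (\<Sum>m. inverse (fact m) * 1 ^ m)"
    by (rule suminf_mult[OF se])
  also have "\<dots> \<le> L ^ (2 * k + n) / fact n * 3"
    using L by (intro mult_left_mono e) auto
  finally show ?thesis by (simp add: a_def mult.commute)
qed

lemma BesselJ_minus: "BesselJ (- int n) x = (-1) ^ n * BesselJ (int n) x"
  by (cases "n = 0") (auto simp: BesselJ_def)

lemma abs_BesselJ_le:
  assumes L: "0 \<le> L" "L \<le> 1"
  shows "\<bar>BesselJ n (2 * L)\<bar> \<le> 6 * L ^ nat \<bar>n\<bar> * geo n"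
proof -
  have A: "\<bar>BesselJ (int k) (2 * L)\<bar> \<le> 6 * L ^ k * geo (int k)" for k
  proof -
    have "\<bar>BesselJ (int k) (2 * L)\<bar> \<le> 3 * L ^ k * (1 / fact k)"
      using BesselJ_truncate[OF L, of k 0] by simp
    also have "\<dots> \<le> 3 * L ^ k * (2 * geo (int k))"
      using L by (intro mult_left_mono inverse_fact_le_geo) auto
    finally show ?thesis by simp
  qed
  show ?thesis
  proof (cases "n \<ge> 0")
    case True
    then show ?thesis using A[of "nat n"] by simp
  next
    case False
    then have "n = - int (nat (- n))" by simp
    then obtain k where "n = - int k" by blast
    then show ?thesis using A[of k] by (simp add: BesselJ_minus abs_mult)
  qed
qed

text \<open>Surplus powers of \<open>L\<close> are discarded since \<open>L \<le> 1\<close>, whereas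
  both weights \<open>geo\<close> are kept for the later summation over the kernel index.\<close>

lemma BesselJ_mult_le:
  assumes L: "0 \<le> L" "L \<le> 1" and k: "int k \<le> \<bar>n\<bar> + \<bar>m\<bar>"
  shows "\<bar>BesselJ n (2 * L) * BesselJ m (2 * L)\<bar> \<le> 36 * L ^ k * (geo n * geo m)"
proof -
  have "\<bar>BesselJ n (2 * L) * BesselJ m (2 * L)\<bar> \<le> (6 * L ^ nat \<bar>n\<bar> * geo n) * (6 * L ^ nat \<bar>m\<bar> * geo m)"
    unfolding abs_mult using L by (intro mult_mono abs_BesselJ_le) auto
  also have "\<dots> = 36 * L ^ (nat \<bar>n\<bar> + nat \<bar>m\<bar>) * (geo n * geo m)"
    by (simp add: power_add mult_ac)
  also have "\<dots> \<le> 36 * L ^ k * (geo n * geo m)"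
    using L k by (intro mult_right_mono mult_left_mono power_decreasing) auto
  finally show ?thesis .
qed

lemma BesselJ_0_1_expansions:
  assumes L: "0 \<le> L" "L \<le> 1"
  shows "\<bar>BesselJ 0 (2 * L) - 1\<bar> \<le> 3 * L ^ 2"
    and "\<bar>BesselJ 0 (2 * L) - (1 - L ^ 2)\<bar> \<le> 3 * L ^ 4"
    and "\<bar>BesselJ 1 (2 * L) - L\<bar> \<le> 3 * L ^ 3"
    and "\<bar>BesselJ 0 (2 * L)\<bar> \<le> 6" and "\<bar>BesselJ 1 (2 * L)\<bar> \<le> 3 * L"
  using BesselJ_truncate[OF L, of 0 1] BesselJ_truncate[OF L, of 0 2] BesselJ_truncate[OF L, of 1 1]
    abs_BesselJ_le[OF L, of 0] abs_BesselJ_le[OF L, of 1]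
  by (simp_all add: numeral_2_eq_2 geo_def eval_nat_numeral)

text \<open>At \<open>L = 0\<close> only \<open>n = m = 0\<close> survives. Otherwise the order |n|
  + |m| is at least |n - m|, and at least 2 if n = m; \<open>band\<close> records exactly
  this.\<close>

lemma BesselJ_mult_expansion_0:
  assumes L: "0 \<le> L" "L \<le> 1"
  shows "\<bar>BesselJ n (2 * L) * BesselJ m (2 * L) - of_bool (n = 0 \<and> m = 0)\<bar>
    \<le> 48 * L ^ band (n - m) * (geo n * geo m)"
proof (cases "n = 0 \<and> m = 0")
  case True
  have "\<bar>BesselJ 0 (2 * L) * BesselJ 0 (2 * L) - 1\<bar> = \<bar>BesselJ 0 (2 * L) - 1\<bar> * \<bar>BesselJ 0 (2 * L) + 1\<bar>"
    by (simp add: abs_mult[symmetric] algebra_simps)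
  also have "\<dots> \<le> (3 * L ^ 2) * 7"
    using BesselJ_0_1_expansions[OF L] by (intro mult_mono) auto
  also have "\<dots> \<le> 48 * L ^ 2" by simp
  finally show ?thesis using True by (simp add: band_def geo_def)
next
  case False
  then have "int (band (n - m)) \<le> \<bar>n\<bar> + \<bar>m\<bar>" by (auto simp: band_def)
  then have "\<bar>BesselJ n (2 * L) * BesselJ m (2 * L)\<bar> \<le> 36 * L ^ band (n - m) * (geo n * geo m)"
    by (rule BesselJ_mult_le[OF L])
  also have "\<dots> \<le> 48 * L ^ band (n - m) * (geo n * geo m)"
    using L by (intro mult_right_mono) auto
  finally show ?thesis using False by auto
qed

text \<open>From J_0(2L) = 1 - L^2 + O(L^4) and J_1(2L) = L + O(L^3); for |n| >= 2 the square
  already has order 2|n| >= 4.\<close>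

lemma BesselJ_square_expansion:
  assumes L: "0 \<le> L" "L \<le> 1"
  shows "\<bar>BesselJ n (2 * L) * BesselJ n (2 * L) - (if n = 0 then 1 - 2 * L ^ 2 else if \<bar>n\<bar> = 1 then L ^ 2 else 0)\<bar>
    \<le> 48 * L ^ 4 * (geo n * geo n)"
proof -
  let ?x = "BesselJ 0 (2 * L)" and ?y = "BesselJ 1 (2 * L)"
  consider "n = 0" | "\<bar>n\<bar> = 1" | "\<bar>n\<bar> \<ge> 2" by linarith
  then show ?thesis
  proof cases
    case 1
    have "?x * ?x - (1 - 2 * L ^ 2) = (?x - (1 - L ^ 2)) * (?x + (1 - L ^ 2)) + L ^ 4"
      by (simp add: algebra_simps eval_nat_numeral)
    then have "\<bar>?x * ?x - (1 - 2 * L ^ 2)\<bar> \<le> \<bar>?x - (1 - L ^ 2)\<bar> * \<bar>?x + (1 - L ^ 2)\<bar> + L ^ 4"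
      using abs_triangle_ineq[of "(?x - (1 - L ^ 2)) * (?x + (1 - L ^ 2))" "L ^ 4"] L by (simp add: abs_mult)
    also have "\<dots> \<le> (3 * L ^ 4) * 7 + L ^ 4"
    proof (intro add_mono mult_mono order.refl)
      have "0 \<le> L ^ 2" "L ^ 2 \<le> 1" using L by (auto simp: power_le_one)
      then show "\<bar>?x + (1 - L ^ 2)\<bar> \<le> 7" using BesselJ_0_1_expansions(4)[OF L] by linarith
    qed (use BesselJ_0_1_expansions[OF L] L in auto)
    also have "\<dots> \<le> 48 * L ^ 4" by simp
    finally show ?thesis using 1 by (simp add: geo_def)
  next
    case 2
    then have "n = 1 \<or> n = - int 1" by auto
    then have E: "BesselJ n (2 * L) * BesselJ n (2 * L) = ?y * ?y"
      using BesselJ_minus[of 1 "2 * L"] by auto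
    have "\<bar>?y * ?y - L ^ 2\<bar> = \<bar>?y - L\<bar> * \<bar>?y + L\<bar>"
      by (simp add: abs_mult[symmetric] algebra_simps power2_eq_square)
    also have "\<dots> \<le> (3 * L ^ 3) * (4 * L)"
      using BesselJ_0_1_expansions[OF L] L by (intro mult_mono) auto
    \<comment> \<open>Origin of the common constant 48: the bound is 12, and
      \<open>geo n * geo n\<close> is 1/4.\<close>
    also have "\<dots> = 48 * L ^ 4 * (geo n * geo n)"
      using 2 by (simp add: geo_def eval_nat_numeral)
    finally show ?thesis using 2 E by auto
  next
    case 3
    then have "\<bar>BesselJ n (2 * L) * BesselJ n (2 * L)\<bar> \<le> 36 * L ^ 4 * (geo n * geo n)"
      by (intro BesselJ_mult_le[OF L]) auto
    also have "\<dots> \<le> 48 * L ^ 4 * (geo n * geo n)"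
      using L by (intro mult_right_mono) auto
    finally show ?thesis using 3 by auto
  qed
qed

text \<open>The order |n| + |n + 1| is 1 for n = 0 and n = -1, and at least 3 otherwise. The
  opposite signs stem from J_(-1) = - J_1 and produce a first difference of \<open>\<tau>\<close>
  next to the diagonal of the kernel.\<close>

lemma BesselJ_adjacent_expansion:
  assumes L: "0 \<le> L" "L \<le> 1"
  shows "\<bar>BesselJ n (2 * L) * BesselJ (n + 1) (2 * L) - (if n = 0 then L else if n = - 1 then - L else 0)\<bar>
    \<le> 48 * L ^ 3 * (geo n * geo (n + 1))"
proof -
  let ?x = "BesselJ 0 (2 * L)" and ?y = "BesselJ 1 (2 * L)"
  have A: "\<bar>?x * ?y - L\<bar> \<le> 24 * L ^ 3"
  proof -
    have "?x * ?y - L = ?x * (?y - L) + (?x - 1) * L" by (simp add: algebra_simps)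
    then have "\<bar>?x * ?y - L\<bar> \<le> \<bar>?x\<bar> * \<bar>?y - L\<bar> + \<bar>?x - 1\<bar> * L"
      using abs_triangle_ineq[of "?x * (?y - L)" "(?x - 1) * L"] L by (simp add: abs_mult)
    also have "\<dots> \<le> 6 * (3 * L ^ 3) + (3 * L ^ 2) * L"
      using BesselJ_0_1_expansions[OF L] L by (intro add_mono mult_mono) auto
    also have "\<dots> \<le> 24 * L ^ 3" using L by (simp add: eval_nat_numeral)
    finally show ?thesis .
  qed
  consider "n = 0" | "n = -1" | "n \<noteq> 0 \<and> n \<noteq> -1" by linarith
  then show ?thesis
  proof cases
    case 1
    then show ?thesis using A by (simp add: geo_def)
  next
    case 2
    have "\<bar>- (?x * ?y) - (- L)\<bar> \<le> 24 * L ^ 3" using A by linarith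
    moreover have "BesselJ (- 1) (2 * L) = - ?y" using BesselJ_minus[of 1 "2 * L"] by simp
    ultimately show ?thesis using 2 by (simp add: geo_def mult.commute)
  next
    case 3
    then have "\<bar>BesselJ n (2 * L) * BesselJ (n + 1) (2 * L)\<bar> \<le> 36 * L ^ 3 * (geo n * geo (n + 1))"
      by (intro BesselJ_mult_le[OF L]) auto
    also have "\<dots> \<le> 48 * L ^ 3 * (geo n * geo (n + 1))"
      using L by (intro mult_right_mono) auto
    finally show ?thesis using 3 by auto
  qed
qed

section \<open>The kernel as a sum over the integers and its summable majorant\<close>

lemma geo_summable: "geo summable_on UNIV"
proof -
  have "(\<lambda>n::nat. (1/2::real) ^ n) summable_on UNIV"
    by (rule summable_nonneg_imp_summable_on) (auto simp: summable_geometric)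
  then have n: "(\<lambda>n. geo (int n)) summable_on UNIV" by (simp add: geo_def)
  have 1: "geo summable_on range int"
    using n by (subst summable_on_reindex) (auto simp: o_def)
  have 2: "geo summable_on range (\<lambda>n. - int n)"
    using n by (subst summable_on_reindex) (auto simp: o_def inj_on_def)
  have "x \<in> range int \<union> range (\<lambda>n. - int n)" for x :: int
    by (cases x rule: int_cases2) auto
  then have "range int \<union> range (\<lambda>n. - int n) = UNIV"
    by blast
  then show ?thesis
    using summable_on_union[OF 1 2] by simp
qed

lemma geo_shift_summable: "(\<lambda>k. geo (i - k)) summable_on UNIV"
proof -
  have "bij (\<lambda>k::int. i - k)" by (rule bij_betw_byWitness[of _ "\<lambda>k. i - k"]) auto
  then show ?thesis
    using geo_summable summable_on_reindex_bij_betw[of "\<lambda>k::int. i - k" UNIV UNIV geo] by simp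
qed

(* Coordinates a = s + 1 + i, b = s + 1 + j, l = - s - 1 - k with i, j natural and k an integer:
   then a + l = i - k and the kernel of the paper is sandwich tau J with tau k = sigma (- s - 1 - k).
   With geo in place of J one gets a summable majorant. *)
definition sandwich :: "(int \<Rightarrow> real) \<Rightarrow> (int \<Rightarrow> real) \<Rightarrow> nat \<Rightarrow> nat \<Rightarrow> real" where
  "sandwich \<tau> b i j = (\<Sum>\<^sub>\<infinity>k. \<tau> k * (b (int i - k) * b (int j - k)))"

lemma sandwich_geo_summable:
  assumes "\<And>k. 0 \<le> \<tau> k \<and> \<tau> k \<le> 1"
  shows "(\<lambda>k. \<tau> k * (geo (int i - k) * geo (int j - k))) summable_on UNIV"
proof (rule summable_on_comparison_test[OF geo_shift_summable[of "int i"]])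
  fix k
  have "\<tau> k * (geo (int i - k) * geo (int j - k)) \<le> 1 * (geo (int i - k) * 1)"
    using assms[of k] by (intro mult_mono) auto
  then show "\<tau> k * (geo (int i - k) * geo (int j - k)) \<le> geo (int i - k)" by simp
  show "0 \<le> \<tau> k * (geo (int i - k) * geo (int j - k))" using assms[of k] by auto
qed

text \<open>\<open>p\<close> is the finitely supported principal part of the products of Bessel
  values. What remains is dominated by a summable family, so the sum splits and a bound for each
  \<open>k\<close> passes to the kernel with the same \<open>c\<close>.\<close>

lemma sandwich_approx:
  assumes \<tau>: "\<And>k. 0 \<le> \<tau> k \<and> \<tau> k \<le> 1" and F: "finite F" "\<And>k. k \<notin> F \<Longrightarrow> p k = 0"
    and bd: "\<And>k. \<bar>b (int i - k) * b (int j - k) - p k\<bar> \<le> c * (geo (int i - k) * geo (int j - k))"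
  shows "\<bar>sandwich \<tau> b i j - (\<Sum>k\<in>F. \<tau> k * p k)\<bar> \<le> c * sandwich \<tau> geo i j"
proof -
  define e where "e k = \<tau> k * (b (int i - k) * b (int j - k) - p k)" for k
  have hs: "((\<lambda>k. c * (\<tau> k * (geo (int i - k) * geo (int j - k)))) has_sum c * sandwich \<tau> geo i j) UNIV"
    unfolding sandwich_def by (intro has_sum_cmult_right has_sum_infsum sandwich_geo_summable \<tau>)
  have le: "norm (e k) \<le> c * (\<tau> k * (geo (int i - k) * geo (int j - k)))" for k
  proof -
    have "norm (e k) = \<tau> k * \<bar>b (int i - k) * b (int j - k) - p k\<bar>"
      using \<tau>[of k] by (simp add: e_def abs_mult)
    also have "\<dots> \<le> \<tau> k * (c * (geo (int i - k) * geo (int j - k)))"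
      using \<tau>[of k] by (intro mult_left_mono bd) auto
    finally show ?thesis by (simp add: mult_ac)
  qed
  have se: "(\<lambda>k. norm (e k)) summable_on UNIV"
    by (rule summable_on_comparison_test[OF has_sum_imp_summable[OF hs]]) (use le in auto)
  then have se': "e summable_on UNIV" by (rule abs_summable_summable)
  have hp: "((\<lambda>k. \<tau> k * p k) has_sum (\<Sum>k\<in>F. \<tau> k * p k)) UNIV"
    by (rule has_sum_finite_neutralI) (use F in auto)
  have "((\<lambda>k. e k + \<tau> k * p k) has_sum (infsum e UNIV + (\<Sum>k\<in>F. \<tau> k * p k))) UNIV"
    by (intro has_sum_add has_sum_infsum se' hp)
  moreover have "(\<lambda>k. e k + \<tau> k * p k) = (\<lambda>k. \<tau> k * (b (int i - k) * b (int j - k)))"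
    by (auto simp: e_def algebra_simps)
  ultimately have "sandwich \<tau> b i j = infsum e UNIV + (\<Sum>k\<in>F. \<tau> k * p k)"
    unfolding sandwich_def by (metis infsumI)
  then have "\<bar>sandwich \<tau> b i j - (\<Sum>k\<in>F. \<tau> k * p k)\<bar> = norm (infsum e UNIV)" by simp
  also have "\<dots> \<le> infsum (\<lambda>k. norm (e k)) UNIV" by (rule norm_infsum_bound[OF se])
  also have "\<dots> \<le> c * sandwich \<tau> geo i j"
    using has_sum_mono[OF has_sum_infsum[OF se] hs] le by auto
  finally show ?thesis .
qed

lemma sandwich_geo_nonneg:
  assumes "\<And>k. 0 \<le> \<tau> k \<and> \<tau> k \<le> 1"
  shows "sandwich \<tau> geo i j \<ge> 0"
  unfolding sandwich_def using assms by (intro infsum_nonneg) auto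

lemma sandwich_commute: "sandwich \<tau> b i j = sandwich \<tau> b j i"
  unfolding sandwich_def by (simp add: mult.commute)

lemma has_sum_finite_sum:
  fixes f :: "'a \<Rightarrow> 'b \<Rightarrow> 'c::topological_comm_monoid_add"
  assumes "finite A" "\<And>a. a \<in> A \<Longrightarrow> (f a has_sum S a) B"
  shows "((\<lambda>x. \<Sum>a\<in>A. f a x) has_sum (\<Sum>a\<in>A. S a)) B"
  using assms by (induction A rule: finite_induct) (auto intro!: has_sum_add)

text \<open>Interchanging sums gives sum_k tau_k * (sum_i geo (i - k))^2. For k >= 0 the inner sum
  is at most the total mass \<open>G\<close> and summability of \<open>\<tau>\<close> applies; for k
  < 0 it is at most 2 * geo k, whence the bound 4 * geo k.\<close>

lemma sandwich_geo_sum_bounded: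
  assumes \<tau>: "\<And>k. 0 \<le> \<tau> k \<and> \<tau> k \<le> 1" and s: "\<tau> summable_on {0..}"
  obtains R where "\<And>N. (\<Sum>i<N. \<Sum>j<N. sandwich \<tau> geo i j) \<le> R"
proof -
  define G where "G = infsum geo UNIV"
  define B where "B k = (if k \<ge> 0 then G\<^sup>2 * \<tau> k else 4 * geo k)" for k
  have "B summable_on {0..}"
    using summable_on_cmult_right[OF s, of "G\<^sup>2"] by (rule summable_on_cong[THEN iffD1, rotated]) (auto simp: B_def)
  moreover have "B summable_on {..<0}"
    using summable_on_cmult_right[OF summable_on_subset_banach[OF geo_summable], of "{..<0}" 4]
    by (rule summable_on_cong[THEN iffD1, rotated]) (auto simp: B_def)
  ultimately have "B summable_on ({0..} \<union> {..<0})" by (rule summable_on_union)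
  moreover have "{0..} \<union> {..<0} = (UNIV :: int set)" by auto
  ultimately have sB: "B summable_on UNIV" by simp
  have le: "\<tau> k * ((\<Sum>i<N. geo (int i - k)) * (\<Sum>i<N. geo (int i - k))) \<le> B k" for k N
  proof (cases "k \<ge> 0")
    case True
    have "(\<Sum>i<N. geo (int i - k)) = sum geo ((\<lambda>i. int i - k) ` {..<N})"
      by (subst sum.reindex) (auto simp: inj_on_def)
    also have "\<dots> \<le> G" unfolding G_def
      by (rule finite_sum_le_infsum[OF geo_summable]) auto
    finally have "(\<Sum>i<N. geo (int i - k)) * (\<Sum>i<N. geo (int i - k)) \<le> G * G"
      by (intro mult_mono) (auto intro: sum_nonneg infsum_nonneg simp: G_def)
    then show ?thesis using True \<tau>[of k] by (simp add: B_def power2_eq_square mult.commute[of _ "\<tau> k"] mult_left_mono)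
  next
    case False
    have "(\<Sum>i<N. geo (int i - k)) = (\<Sum>i<N. geo k * (1/2) ^ i)"
    proof (rule sum.cong[OF refl])
      fix i
      have "nat \<bar>int i - k\<bar> = nat \<bar>k\<bar> + i" using False by simp
      then show "geo (int i - k) = geo k * (1/2) ^ i" by (simp add: geo_def power_add)
    qed
    also have "\<dots> = geo k * (\<Sum>i<N. (1/2) ^ i)" by (simp add: sum_distrib_left)
    also have "\<dots> \<le> geo k * 2"
      by (intro mult_left_mono) (simp_all add: geometric_sum)
    finally have "(\<Sum>i<N. geo (int i - k)) * (\<Sum>i<N. geo (int i - k)) \<le> (geo k * 2) * (geo k * 2)"
      by (intro mult_mono) (auto intro: sum_nonneg)
    also have "\<dots> \<le> (geo k * 2) * 2" by (intro mult_left_mono) auto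
    finally have "(\<Sum>i<N. geo (int i - k)) * (\<Sum>i<N. geo (int i - k)) \<le> 4 * geo k" by simp
    moreover have "\<tau> k * x \<le> x" if "x \<ge> 0" for x
      using mult_right_mono[of "\<tau> k" 1 x] that \<tau>[of k] by simp
    ultimately have "\<tau> k * ((\<Sum>i<N. geo (int i - k)) * (\<Sum>i<N. geo (int i - k))) \<le> 4 * geo k"
      by (meson order_trans zero_le_square)
    then show ?thesis using False by (simp add: B_def)
  qed
  have "(\<Sum>i<N. \<Sum>j<N. sandwich \<tau> geo i j) \<le> infsum B UNIV" for N
  proof -
    have hs: "((\<lambda>k. \<Sum>i<N. \<Sum>j<N. \<tau> k * (geo (int i - k) * geo (int j - k))) has_sum
        (\<Sum>i<N. \<Sum>j<N. sandwich \<tau> geo i j)) UNIV"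
      unfolding sandwich_def by (intro has_sum_finite_sum has_sum_infsum sandwich_geo_summable \<tau> finite_lessThan)
    have "(\<Sum>i<N. \<Sum>j<N. \<tau> k * (geo (int i - k) * geo (int j - k))) =
       \<tau> k * ((\<Sum>i<N. geo (int i - k)) * (\<Sum>i<N. geo (int i - k)))" for k
      unfolding sum_product by (simp only: sum_distrib_left)
    then show ?thesis
      using has_sum_mono[OF hs has_sum_infsum[OF sB]] le by simp
  qed
  then show ?thesis using that by blast
qed

section \<open>Second-order expansion of a banded determinant\<close>

lemma leibniz_det_empty: "leibniz_det {} A = 1"
  and leibniz_perm_empty: "leibniz_perm {} A = 1"
  and leibniz_det_singleton: "leibniz_det {a} A = A a a"
  and leibniz_perm_singleton: "leibniz_perm {a} A = A a a"
  by (simp_all add: leibniz_det_def leibniz_perm_def)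

lemma permutations_doubleton: "{p. p permutes {a, b}} = {id, Transposition.transpose a b}"
  by (auto simp: permutes_doubleton_iff)

lemma leibniz_doubleton:
  assumes "a \<noteq> b"
  shows "leibniz_det {a, b} A = A a a * A b b - A a b * A b a"
    and "leibniz_perm {a, b} A = A a a * A b b + A a b * A b a"
proof -
  have "id \<noteq> Transposition.transpose a b" using assms by (metis id_apply transpose_apply_first)
  then show "leibniz_det {a, b} A = A a a * A b b - A a b * A b a"
    and "leibniz_perm {a, b} A = A a a * A b b + A a b * A b a"
    using assms by (simp_all add: leibniz_det_def leibniz_perm_def permutations_doubleton sign_swap_id)
qed

(* For card T = 3 this is a parity argument: the displacements i - p i sum to zero, so they cannot
   all be odd. *)
lemma sum_band_permutation_ge:
  fixes T :: "nat set"
  assumes T: "finite T" "card T \<ge> 3" and p: "p permutes T"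
  shows "4 \<le> (\<Sum>i\<in>T. band (int i - int (p i)))"
proof (rule ccontr)
  assume "\<not> ?thesis"
  then have lt: "(\<Sum>i\<in>T. band (int i - int (p i))) \<le> 3" by simp
  have ge1: "(\<Sum>i\<in>T. 1) \<le> (\<Sum>i\<in>T. band (int i - int (p i)))"
    by (intro sum_mono) (simp add: band_def)
  then have c3: "card T = 3" using T lt by simp
  have "\<bar>int i - int (p i)\<bar> = 1" if "i \<in> T" for i
  proof (rule ccontr)
    assume "\<bar>int i - int (p i)\<bar> \<noteq> 1"
    then have "(\<Sum>i\<in>T. 1) < (\<Sum>i\<in>T. band (int i - int (p i)))"
      using that T by (intro sum_strict_mono_ex1) (auto simp: band_def)
    then show False using lt c3 by simp
  qed
  then have "odd (int i - int (p i))" if "i \<in> T" for i using that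
    by (metis abs_if even_minus odd_one)
  then have "{i \<in> T. odd (int i - int (p i))} = T" by auto
  then have "odd (\<Sum>i\<in>T. int i - int (p i))"
    using even_sum_iff[OF T(1), of "\<lambda>i. int i - int (p i)"] c3 by simp
  moreover have "(\<Sum>i\<in>T. int i - int (p i)) = 0"
    using sum.permute[OF p, of int] by (simp add: sum_subtractf o_def)
  ultimately show False by simp
qed

lemma abs_leibniz_det_banded_le:
  fixes M h :: "nat \<Rightarrow> nat \<Rightarrow> real"
  assumes L: "0 \<le> L" "L \<le> 1" and T: "finite T" "card T \<ge> 3"
    and M: "\<And>i j. \<bar>M i j\<bar> \<le> L ^ band (int i - int j) * h i j" and h: "\<And>i j. h i j \<ge> 0"
  shows "\<bar>leibniz_det T M\<bar> \<le> L ^ 4 * leibniz_perm T h"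
proof -
  have "\<bar>leibniz_det T M\<bar> \<le> leibniz_perm T (\<lambda>i j. L ^ band (int i - int j) * h i j)"
    by (rule abs_leibniz_det_le) (rule M)
  also have "\<dots> \<le> (\<Sum>p | p permutes T. L ^ 4 * (\<Prod>i\<in>T. h i (p i)))"
    unfolding leibniz_perm_def
  proof (rule sum_mono)
    fix p assume "p \<in> {p. p permutes T}"
    then have "4 \<le> (\<Sum>i\<in>T. band (int i - int (p i)))" by (intro sum_band_permutation_ge T) auto
    then have "L ^ (\<Sum>i\<in>T. band (int i - int (p i))) \<le> L ^ 4" using L by (intro power_decreasing) auto
    then show "(\<Prod>i\<in>T. L ^ band (int i - int (p i)) * h i (p i)) \<le> L ^ 4 * (\<Prod>i\<in>T. h i (p i))"
      by (simp add: prod.distrib power_sum[symmetric] mult_right_mono prod_nonneg h)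
  qed
  finally show ?thesis by (simp add: leibniz_perm_def sum_distrib_left)
qed

(* The part of the signed principal minor indexed by T that matters modulo L^4, with x = L^2:
   only the empty set, singletons and pairs of neighbours contribute. *)
definition low_order_term :: "(nat \<Rightarrow> real) \<Rightarrow> (nat \<Rightarrow> real) \<Rightarrow> real \<Rightarrow> nat \<Rightarrow> nat set \<Rightarrow> real" where
  "low_order_term u v x N T = of_bool (T = {}) -
     x * ((\<Sum>i<Suc N. of_bool (T = {i}) * u i) + (\<Sum>i<N. of_bool (T = {i, Suc i}) * v i))"

text \<open>\<open>Suc N\<close> points give \<open>Suc N\<close> singletons but only
  \<open>N\<close> neighbouring pairs, each matched by exactly one \<open>T\<close>.\<close>

lemma sum_low_order_term:
  "(\<Sum>T\<in>Pow {..<Suc N}. low_order_term u v x N T) = 1 - x * ((\<Sum>i<Suc N. u i) + (\<Sum>i<N. v i))"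
proof -
  have a: "(\<Sum>T\<in>Pow {..<Suc N}. of_bool (T = {})) = (1::real)"
    by (subst sum_of_bool_eq) auto
  have "(\<Sum>T\<in>Pow {..<Suc N}. \<Sum>i<Suc N. of_bool (T = {i}) * u i) =
      (\<Sum>i<Suc N. \<Sum>T\<in>Pow {..<Suc N}. of_bool (T = {i}) * u i)" by (rule sum.swap)
  also have "\<dots> = (\<Sum>i<Suc N. u i)"
    by (intro sum.cong refl) (simp add: of_bool_def if_distrib[of "\<lambda>x. x * _"] sum.delta cong: if_cong)
  finally have b: "(\<Sum>T\<in>Pow {..<Suc N}. \<Sum>i<Suc N. of_bool (T = {i}) * u i) = (\<Sum>i<Suc N. u i)" .
  have "(\<Sum>T\<in>Pow {..<Suc N}. \<Sum>i<N. of_bool (T = {i, Suc i}) * v i) =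
      (\<Sum>i<N. \<Sum>T\<in>Pow {..<Suc N}. of_bool (T = {i, Suc i}) * v i)" by (rule sum.swap)
  also have "\<dots> = (\<Sum>i<N. v i)"
    by (intro sum.cong refl) (simp add: of_bool_def if_distrib[of "\<lambda>x. x * _"] sum.delta cong: if_cong)
  finally have c: "(\<Sum>T\<in>Pow {..<Suc N}. \<Sum>i<N. of_bool (T = {i, Suc i}) * v i) = (\<Sum>i<N. v i)" .
  show ?thesis
    unfolding low_order_term_def
    by (simp only: sum_subtractf sum_distrib_left[symmetric] sum.distrib a b c)
qed

text \<open>The case split is by \<open>card T\<close>. For two points the permanent adds both
  products of the 2 x 2 minor, so it covers the errors of both; the factor 3 is inherited from the
  hypothesis on neighbouring pairs.\<close>

lemma principal_minor_approx:
  fixes M h :: "nat \<Rightarrow> nat \<Rightarrow> real"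
  assumes L: "0 \<le> L" "L \<le> 1" and T: "T \<subseteq> {..<Suc N}"
    and M0: "\<And>i j. \<bar>M i j\<bar> \<le> L ^ band (int i - int j) * h i j" and h: "\<And>i j. h i j \<ge> 0"
    and M1: "\<And>i. \<bar>M i i - L\<^sup>2 * u i\<bar> \<le> L ^ 4 * h i i"
    and M2: "\<And>i. \<bar>M i (Suc i) * M (Suc i) i - L\<^sup>2 * v i\<bar> \<le> 3 * L ^ 4 * (h i (Suc i) * h (Suc i) i)"
  shows "\<bar>(-1) ^ card T * leibniz_det T M - low_order_term u v (L\<^sup>2) N T\<bar> \<le> 3 * L ^ 4 * leibniz_perm T h"
proof -
  have fT: "finite T" using T finite_subset by blast
  have L4: "L ^ 4 \<ge> 0" using L by simp
  have sq: "L ^ 2 * x * (L ^ 2 * y) = L ^ 4 * (x * y)" for x y by (simp add: eval_nat_numeral)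
  consider "T = {}" | a where "T = {a}" | "card T = 2" | "card T \<ge> 3"
    by (metis One_nat_def card_0_eq card_1_singletonE fT le_Suc_eq less_2_cases not_less_eq_eq numeral_2_eq_2 numeral_3_eq_3 not_le)
  then show ?thesis
  proof cases
    case 1
    then show ?thesis using L by (simp add: leibniz_det_empty leibniz_perm_empty low_order_term_def)
  next
    case 2
    have "(\<Sum>i<Suc N. of_bool (T = {i}) * u i) = u a"
      using T by (simp add: 2 of_bool_def if_distrib[of "\<lambda>x. x * _"] sum.delta' del: sum.lessThan_Suc cong: if_cong)
    moreover have "(\<Sum>i<N. of_bool (T = {i, Suc i}) * v i) = 0"
      by (intro sum.neutral) (auto simp: 2)
    ultimately have "low_order_term u v (L\<^sup>2) N T = - (L\<^sup>2 * u a)"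
      by (simp add: low_order_term_def 2)
    then have "\<bar>(-1) ^ card T * leibniz_det T M - low_order_term u v (L\<^sup>2) N T\<bar> = \<bar>M a a - L\<^sup>2 * u a\<bar>"
      by (simp add: 2 leibniz_det_singleton)
    also have "\<dots> \<le> L ^ 4 * h a a" by (rule M1)
    also have "\<dots> \<le> 3 * L ^ 4 * h a a" using L4 h by (simp add: mult_right_mono)
    finally show ?thesis by (simp add: 2 leibniz_perm_singleton)
  next
    case 3
    then obtain a b where ab0: "T = {a, b}" "a \<noteq> b" by (auto simp: card_2_iff)
    have "\<exists>a b. T = {a, b} \<and> a < b"
    proof (cases "a < b")
      case False
      then have "T = {b, a}" "b < a" using ab0 by auto
      then show ?thesis by blast
    qed (use ab0 in blast)
    then obtain a b where ab: "T = {a, b}" "a < b" by blast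
    \<comment> \<open>Both diagonal entries are of order L^2, so their product belongs to the
      error.\<close>
    have diag: "\<bar>M a a * M b b\<bar> \<le> L ^ 4 * (h a a * h b b)"
    proof -
      have "\<bar>M a a * M b b\<bar> \<le> (L ^ 2 * h a a) * (L ^ 2 * h b b)"
        unfolding abs_mult using M0[of a a] M0[of b b] h L by (intro mult_mono) (auto simp: band_def)
      then show ?thesis by (simp only: sq)
    qed
    have lo: "low_order_term u v (L\<^sup>2) N T = (if b = Suc a then - (L\<^sup>2 * v a) else 0)"
    proof -
      have "(\<Sum>i<Suc N. of_bool (T = {i}) * u i) = 0"
        using ab by (intro sum.neutral) auto
      moreover have "(\<Sum>i<N. of_bool (T = {i, Suc i}) * v i) = (\<Sum>i<N. if i = a then of_bool (b = Suc a) * v a else 0)"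
        using ab by (intro sum.cong refl) (auto simp: doubleton_eq_iff)
      moreover have "\<dots> = (if b = Suc a then v a else 0)"
        using ab T by auto
      moreover have "T \<noteq> {}" using ab by simp
      ultimately show ?thesis unfolding low_order_term_def by simp
    qed
    have off: "\<bar>M a b * M b a - (if b = Suc a then L\<^sup>2 * v a else 0)\<bar> \<le> 3 * L ^ 4 * (h a b * h b a)"
    proof (cases "b = Suc a")
      case True
      then show ?thesis using M2[of a] by simp
    next
      case False
      \<comment> \<open>At distance at least 2 both entries are of order L^2; hence only neighbours
        enter \<open>low_order_term\<close>.\<close>
      have "\<bar>M a b * M b a\<bar> \<le> (L ^ 2 * h a b) * (L ^ 2 * h b a)"
        unfolding abs_mult using M0[of a b] M0[of b a] h L ab False
        by (intro mult_mono) (auto simp: band_def split: if_splits)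
      then have "\<bar>M a b * M b a\<bar> \<le> L ^ 4 * (h a b * h b a)" by (simp only: sq)
      also have "\<dots> \<le> 3 * L ^ 4 * (h a b * h b a)" using L4 h by (intro mult_right_mono) auto
      finally show ?thesis using False by simp
    qed
    have "(-1) ^ card T * leibniz_det T M - low_order_term u v (L\<^sup>2) N T =
       M a a * M b b - (M a b * M b a - (if b = Suc a then L\<^sup>2 * v a else 0))"
    proof -
      have "leibniz_det T M = M a a * M b b - M a b * M b a"
        using ab by (simp add: leibniz_doubleton)
      then show ?thesis unfolding lo using 3 by simp
    qed
    then have "\<bar>(-1) ^ card T * leibniz_det T M - low_order_term u v (L\<^sup>2) N T\<bar> \<le>
       L ^ 4 * (h a a * h b b) + 3 * L ^ 4 * (h a b * h b a)"
      using diag off by linarith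
    also have "\<dots> \<le> 3 * L ^ 4 * leibniz_perm T h"
      using ab h L4 by (simp add: leibniz_doubleton distrib_left)
    finally show ?thesis .
  next
    case 4
    have "T \<noteq> {}" "T \<noteq> {i}" for i using 4 by auto
    moreover have "T \<noteq> {i, Suc i}" for i using 4 by auto
    ultimately have "low_order_term u v (L\<^sup>2) N T = 0" by (simp add: low_order_term_def)
    then have "\<bar>(-1) ^ card T * leibniz_det T M - low_order_term u v (L\<^sup>2) N T\<bar> = \<bar>leibniz_det T M\<bar>"
      by (simp add: abs_mult)
    also have "\<dots> \<le> L ^ 4 * leibniz_perm T h"
      by (rule abs_leibniz_det_banded_le[OF L fT 4 M0 h])
    also have "\<dots> \<le> 3 * L ^ 4 * leibniz_perm T h"
      using L4 leibniz_perm_nonneg[of T h] h by (intro mult_right_mono) auto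
    finally show ?thesis .
  qed
qed

lemma leibniz_det_approx:
  fixes M h :: "nat \<Rightarrow> nat \<Rightarrow> real"
  assumes L: "0 \<le> L" "L \<le> 1"
    and M0: "\<And>i j. \<bar>M i j\<bar> \<le> L ^ band (int i - int j) * h i j" and h: "\<And>i j. h i j \<ge> 0"
    and M1: "\<And>i. \<bar>M i i - L\<^sup>2 * u i\<bar> \<le> L ^ 4 * h i i"
    and M2: "\<And>i. \<bar>M i (Suc i) * M (Suc i) i - L\<^sup>2 * v i\<bar> \<le> 3 * L ^ 4 * (h i (Suc i) * h (Suc i) i)"
    and R: "\<And>N. (\<Sum>i<N. \<Sum>j<N. h i j) \<le> R"
  shows "\<bar>leibniz_det {..<Suc N} (\<lambda>i j. of_bool (i = j) - M i j)
      - (1 - L\<^sup>2 * ((\<Sum>i<Suc N. u i) + (\<Sum>i<N. v i)))\<bar> \<le> 3 * L ^ 4 * exp R"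
proof -
  have "\<bar>leibniz_det {..<Suc N} (\<lambda>i j. of_bool (i = j) - M i j)
      - (1 - L\<^sup>2 * ((\<Sum>i<Suc N. u i) + (\<Sum>i<N. v i)))\<bar>
    = \<bar>\<Sum>T\<in>Pow {..<Suc N}. (-1) ^ card T * leibniz_det T M - low_order_term u v (L\<^sup>2) N T\<bar>"
    by (simp only: leibniz_det_one_minus[OF finite_lessThan] sum_subtractf sum_low_order_term)
  also have "\<dots> \<le> (\<Sum>T\<in>Pow {..<Suc N}. 3 * L ^ 4 * leibniz_perm T h)"
    by (intro sum_abs[THEN order_trans] sum_mono principal_minor_approx[OF L _ M0 h M1 M2]) blast
  also have "\<dots> = 3 * L ^ 4 * (\<Sum>T\<in>Pow {..<Suc N}. leibniz_perm T h)"
    by (rule sum_distrib_left[symmetric])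
  also have "\<dots> \<le> 3 * L ^ 4 * exp (\<Sum>i<Suc N. \<Sum>j<Suc N. h i j)"
    using L by (intro mult_left_mono sum_leibniz_perm_le_exp h) auto
  also have "\<dots> \<le> 3 * L ^ 4 * exp R"
    using L R[of "Suc N"] by (intro mult_left_mono) auto
  finally show ?thesis .
qed

(* The i-th summands of the two sums combine to D i / D (i + 1) - D (i - 1) / D i. *)
lemma second_order_telescope:
  fixes D :: "int \<Rightarrow> real"
  assumes D: "\<And>i::nat. D (int i) \<noteq> 0"
  shows "(\<Sum>i<Suc N. (2 * D (int i) - D (int i - 1) - D (int i + 1)) / D (int i))
       + (\<Sum>i<N. (D (int i + 1) - D (int i))\<^sup>2 / (D (int i) * D (int i + 1)))
    = 2 - D (int N + 1) / D (int N) - D (- 1) / D 0"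
proof (induction N)
  case 0
  show ?case using D[of 0] by (simp add: diff_divide_distrib)
next
  case (Suc N)
  define x where "x = D (int N)"
  define y where "y = D (int N + 1)"
  define z where "z = D (int N + 2)"
  have nz: "x \<noteq> 0" "y \<noteq> 0" using D[of N] D[of "Suc N"] by (auto simp: x_def y_def add.commute)
  have "(2 * D (int (Suc N)) - D (int (Suc N) - 1) - D (int (Suc N) + 1)) / D (int (Suc N)) = (2 * y - x - z) / y"
    by (simp add: x_def y_def z_def add.commute)
  moreover have "(D (int N + 1) - D (int N))\<^sup>2 / (D (int N) * D (int N + 1)) = (y - x)\<^sup>2 / (x * y)"
    by (simp add: x_def y_def)
  moreover have "(2 * y - x - z) / y + (y - x)\<^sup>2 / (x * y) = y / x - z / y"
    using nz by (simp add: field_simps power2_eq_square)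
  moreover have "D (int (Suc N) + 1) / D (int (Suc N)) = z / y"
    by (simp add: y_def z_def add.commute)
  moreover have "D (int N + 1) / D (int N) = y / x" by (simp add: x_def y_def)
  ultimately show ?case using Suc by simp
qed

section \<open>The Bessel kernel determinant\<close>

abbreviation bessel_kernel :: "(int \<Rightarrow> real) \<Rightarrow> real \<Rightarrow> nat \<Rightarrow> nat \<Rightarrow> real" where
  "bessel_kernel \<tau> L \<equiv> sandwich \<tau> (\<lambda>n. BesselJ n (2 * L))"

text \<open>Each bound sums a Bessel product expansion through \<open>sandwich_approx\<close>. The
  first serves the convergence of the Fredholm series. The diagonal is resolved to L^4; beside it
  L^3 suffices, since the partner entry contributes another factor of order L.\<close>

lemma bessel_kernel_bounds:
  assumes L: "0 \<le> L" "L \<le> 1" and \<tau>: "\<And>k. 0 \<le> \<tau> k \<and> \<tau> k \<le> 1"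
  shows "\<bar>bessel_kernel \<tau> L i j\<bar> \<le> 36 * sandwich \<tau> geo i j"
    and "\<bar>bessel_kernel \<tau> L i j - of_bool (i = j) * \<tau> (int i)\<bar>
       \<le> 48 * L ^ band (int i - int j) * sandwich \<tau> geo i j"
    and "\<bar>bessel_kernel \<tau> L i i - (\<tau> (int i) + L\<^sup>2 * (\<tau> (int i - 1) + \<tau> (int i + 1) - 2 * \<tau> (int i)))\<bar>
       \<le> 48 * L ^ 4 * sandwich \<tau> geo i i"
    and "\<bar>bessel_kernel \<tau> L i (Suc i) - L * (\<tau> (int i) - \<tau> (int i + 1))\<bar>
       \<le> 48 * L ^ 3 * sandwich \<tau> geo i (Suc i)"
proof -
  let ?b = "\<lambda>n. BesselJ n (2 * L)"
  show "\<bar>bessel_kernel \<tau> L i j\<bar> \<le> 36 * sandwich \<tau> geo i j"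
    using sandwich_approx[OF \<tau>, of "{}" "\<lambda>_. 0" ?b i j 36] BesselJ_mult_le[OF L, of 0] by simp
  show "\<bar>bessel_kernel \<tau> L i j - of_bool (i = j) * \<tau> (int i)\<bar>
       \<le> 48 * L ^ band (int i - int j) * sandwich \<tau> geo i j"
  proof -
    have "\<bar>sandwich \<tau> ?b i j - (\<Sum>k\<in>{int i}. \<tau> k * of_bool (int i - k = 0 \<and> int j - k = 0))\<bar>
       \<le> 48 * L ^ band (int i - int j) * sandwich \<tau> geo i j"
    proof (rule sandwich_approx[OF \<tau>])
      fix k
      show "\<bar>?b (int i - k) * ?b (int j - k) - of_bool (int i - k = 0 \<and> int j - k = 0)\<bar>
        \<le> 48 * L ^ band (int i - int j) * (geo (int i - k) * geo (int j - k))"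
        using BesselJ_mult_expansion_0[OF L, of "int i - k" "int j - k"] by simp
    qed auto
    then show ?thesis by (cases "i = j") auto
  qed
  show "\<bar>bessel_kernel \<tau> L i i - (\<tau> (int i) + L\<^sup>2 * (\<tau> (int i - 1) + \<tau> (int i + 1) - 2 * \<tau> (int i)))\<bar>
       \<le> 48 * L ^ 4 * sandwich \<tau> geo i i"
  proof -
    define p where "p k = (if int i - k = 0 then 1 - 2 * L ^ 2 else if \<bar>int i - k\<bar> = 1 then L ^ 2 else 0)" for k
    have "\<bar>sandwich \<tau> ?b i i - (\<Sum>k\<in>{int i - 1, int i, int i + 1}. \<tau> k * p k)\<bar>
       \<le> 48 * L ^ 4 * sandwich \<tau> geo i i"
    proof (rule sandwich_approx[OF \<tau>])
      show "\<bar>?b (int i - k) * ?b (int i - k) - p k\<bar> \<le> 48 * L ^ 4 * (geo (int i - k) * geo (int i - k))" for k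
        unfolding p_def by (rule BesselJ_square_expansion[OF L])
    qed (auto simp: p_def)
    moreover have "(\<Sum>k\<in>{int i - 1, int i, int i + 1}. \<tau> k * p k) =
       \<tau> (int i) + L\<^sup>2 * (\<tau> (int i - 1) + \<tau> (int i + 1) - 2 * \<tau> (int i))"
      by (simp add: p_def algebra_simps)
    ultimately show ?thesis by simp
  qed
  show "\<bar>bessel_kernel \<tau> L i (Suc i) - L * (\<tau> (int i) - \<tau> (int i + 1))\<bar>
       \<le> 48 * L ^ 3 * sandwich \<tau> geo i (Suc i)"
  proof -
    define p where "p k = (if int i - k = 0 then L else if int i - k = -1 then - L else 0)" for k
    have "\<bar>sandwich \<tau> ?b i (Suc i) - (\<Sum>k\<in>{int i, int i + 1}. \<tau> k * p k)\<bar>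
       \<le> 48 * L ^ 3 * sandwich \<tau> geo i (Suc i)"
    proof (rule sandwich_approx[OF \<tau>])
      fix k
      have "int (Suc i) - k = int i - k + 1" by simp
      then show "\<bar>?b (int i - k) * ?b (int (Suc i) - k) - p k\<bar>
        \<le> 48 * L ^ 3 * (geo (int i - k) * geo (int (Suc i) - k))"
        using BesselJ_adjacent_expansion[OF L, of "int i - k"] unfolding p_def by metis
    qed (auto simp: p_def)
    moreover have "(\<Sum>k\<in>{int i, int i + 1}. \<tau> k * p k) = L * (\<tau> (int i) - \<tau> (int i + 1))"
      by (simp add: p_def algebra_simps)
    ultimately show ?thesis by simp
  qed
qed

text \<open>Difference of squares: one factor has order L^3, the other is at most 2|x| + |x - L y|
  <= 3 L H.\<close>

lemma abs_square_diff_le: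
  fixes x y :: real
  assumes L: "0 \<le> L" "L \<le> 1" and H: "H \<ge> 0"
    and x: "\<bar>x\<bar> \<le> L * H" and xy: "\<bar>x - L * y\<bar> \<le> L ^ 3 * H"
  shows "\<bar>x * x - L\<^sup>2 * y\<^sup>2\<bar> \<le> 3 * L ^ 4 * (H * H)"
proof -
  have "L ^ 3 * H \<le> L * H"
    using L H power_decreasing[of 1 3 L] by (intro mult_right_mono) auto
  then have s: "\<bar>x + L * y\<bar> \<le> 3 * (L * H)" using x xy by linarith
  have "\<bar>x * x - L\<^sup>2 * y\<^sup>2\<bar> = \<bar>x - L * y\<bar> * \<bar>x + L * y\<bar>"
    by (simp add: abs_mult[symmetric] algebra_simps power2_eq_square)
  also have "\<dots> \<le> (L ^ 3 * H) * (3 * (L * H))"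
    using L H by (intro mult_mono xy s) auto
  finally show ?thesis by (simp add: eval_nat_numeral mult_ac)
qed

lemma summable_on_atLeast_0_imp_summable:
  fixes f :: "int \<Rightarrow> real"
  assumes "f summable_on {0..}"
  shows "summable (\<lambda>i. f (int i))"
proof (rule summable_on_imp_summable)
  have "range int = {0..}"
  proof (intro equalityI subsetI)
    fix x :: int assume "x \<in> {0..}"
    then have "x = int (nat x)" by simp
    then show "x \<in> range int" by blast
  qed auto
  then have "f summable_on range int" using assms by simp
  then show "(\<lambda>i. f (int i)) summable_on UNIV"
    by (subst (asm) summable_on_reindex) (auto simp: o_def)
qed

lemma convergent_prod_one_minus:
  fixes f :: "nat \<Rightarrow> real"
  assumes "summable f" "\<And>i. f i \<ge> 0"
  shows "convergent_prod (\<lambda>i. 1 - f i)"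
  using assms by (intro abs_convergent_prod_imp_convergent_prod summable_imp_abs_convergent_prod) simp

text \<open>The error carries the product as a factor, so it is relative to the leading value; this
  is the form the logarithm requires.\<close>

lemma fredholm_bessel_approx:
  fixes \<tau> :: "int \<Rightarrow> real"
  assumes \<tau>: "\<And>k. 0 \<le> \<tau> k \<and> \<tau> k \<le> 1" and s: "\<tau> summable_on {0..}" and lt1: "\<And>i::nat. \<tau> (int i) < 1"
  obtains C where "\<And>L. 0 \<le> L \<Longrightarrow> L \<le> 1 \<Longrightarrow>
     \<bar>fredholm_det (bessel_kernel \<tau> L) UNIV
       - (\<Prod>i. 1 - \<tau> (int i)) * (1 - (\<tau> (- 1) - \<tau> 0) / (1 - \<tau> 0) * L\<^sup>2)\<bar> \<le> (\<Prod>i. 1 - \<tau> (int i)) * (C * L ^ 4)"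
proof -
  define D where "D k = 1 - \<tau> k" for k
  define P where "P = (\<Prod>i. D (int i))"
  have Dpos: "D (int i) > 0" for i using lt1[of i] by (simp add: D_def)
  note sn = summable_on_atLeast_0_imp_summable[OF s]
  have "convergent_prod (\<lambda>i. D (int i))"
    unfolding D_def by (rule convergent_prod_one_minus[OF sn]) (use \<tau> in auto)
  then have "(\<lambda>n. \<Prod>i\<le>n. D (int i)) \<longlonglongrightarrow> P"
    unfolding P_def by (rule convergent_prod_LIMSEQ)
  then have limP: "(\<lambda>n. \<Prod>i<Suc n. D (int i)) \<longlonglongrightarrow> P"
    by (simp only: lessThan_Suc_atMost)
  have limD: "(\<lambda>i. D (int i)) \<longlonglongrightarrow> 1"
    unfolding D_def using tendsto_diff[OF tendsto_const summable_LIMSEQ_zero[OF sn], of 1] by simp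
  \<comment> \<open>A convergent sequence is bounded: \<open>B\<close> makes the division of rows by
    \<open>D\<close> uniform.\<close>
  have "(\<lambda>i. inverse (D (int i))) \<longlonglongrightarrow> 1"
    using tendsto_inverse[OF limD] by simp
  then have "Bseq (\<lambda>i. inverse (D (int i)))"
    using convergent_imp_Bseq convergentI by blast
  then obtain B where B: "B > 0" "\<And>i. norm (inverse (D (int i))) \<le> B"
    unfolding Bseq_def by auto
  have invB: "1 / D (int i) \<le> B" for i
    using B(2)[of i] Dpos[of i] by (simp add: divide_inverse)
  obtain R where R: "\<And>N. (\<Sum>i<N. \<Sum>j<N. sandwich \<tau> geo i j) \<le> R"
    using sandwich_geo_sum_bounded[OF \<tau> s] by blast
  define h where "h i j = 48 * B * sandwich \<tau> geo i j" for i j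
  have gnn: "sandwich \<tau> geo i j \<ge> 0" for i j by (rule sandwich_geo_nonneg[OF \<tau>])
  have hnn: "h i j \<ge> 0" for i j using B(1) gnn by (simp add: h_def)
  have hR: "(\<Sum>i<N. \<Sum>j<N. h i j) \<le> 48 * B * R" for N
    unfolding h_def sum_distrib_left[symmetric] using B(1) R by (intro mult_left_mono) auto
  \<comment> \<open>\<open>u i\<close> and \<open>v i\<close> are the L^2 coefficients of
    \<open>M i i\<close> and of \<open>M i (Suc i) * M (Suc i) i\<close>, with \<open>\<tau>\<close>
    rewritten as 1 - D.\<close>
  define u where "u i = (2 * D (int i) - D (int i - 1) - D (int i + 1)) / D (int i)" for i :: nat
  define v where "v i = (D (int i + 1) - D (int i))\<^sup>2 / (D (int i) * D (int i + 1))" for i :: nat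
  define c where "c = 1 - D (- 1) / D 0"
  have tele: "(\<Sum>i<Suc N. u i) + (\<Sum>i<N. v i) = 2 - D (int N + 1) / D (int N) - D (- 1) / D 0" for N
    unfolding u_def v_def by (rule second_order_telescope) (use Dpos less_irrefl in metis)
  have limc: "(\<lambda>N. (\<Sum>i<Suc N. u i) + (\<Sum>i<N. v i)) \<longlonglongrightarrow> c"
  proof -
    have "(\<lambda>N. D (int N + 1)) \<longlonglongrightarrow> 1"
      using LIMSEQ_Suc[OF limD] by (simp add: add.commute)
    \<comment> \<open>The boundary ratio at the cut-off tends to 1, which turns the constant 2 into
      1.\<close>
    then have "(\<lambda>N. 2 - D (int N + 1) / D (int N) - D (- 1) / D 0) \<longlonglongrightarrow> 2 - 1 / 1 - D (- 1) / D 0"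
      by (intro tendsto_intros limD) auto
    then show ?thesis unfolding tele c_def by simp
  qed
  have main: "\<bar>fredholm_det (bessel_kernel \<tau> L) UNIV - P * (1 - L\<^sup>2 * c)\<bar>
      \<le> P * (3 * L ^ 4 * exp (48 * B * R))" if L: "0 \<le> L" "L \<le> 1" for L
  proof -
    define K where "K = bessel_kernel \<tau> L"
    define M where "M i j = (K i j - of_bool (i = j) * \<tau> (int i)) / D (int i)" for i j
    note kb = bessel_kernel_bounds[where \<tau> = \<tau>, OF L \<tau>, folded K_def]
    have div: "\<bar>x / D (int i)\<bar> \<le> y * (B * z)" if "\<bar>x\<bar> \<le> y * z" for x y z i
    proof -
      have "\<bar>x / D (int i)\<bar> = \<bar>x\<bar> * (1 / D (int i))" using Dpos[of i] by simp
      also have "\<dots> \<le> (y * z) * B"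
        using that invB[of i] Dpos[of i] by (intro mult_mono) auto
      finally show ?thesis by (simp add: mult_ac)
    qed
    have M0: "\<bar>M i j\<bar> \<le> L ^ band (int i - int j) * h i j" for i j
      using div[where i = i, OF kb(2)[where i = i and j = j]] by (simp add: M_def h_def mult_ac)
    have M1: "\<bar>M i i - L\<^sup>2 * u i\<bar> \<le> L ^ 4 * h i i" for i
    proof -
      have "M i i - L\<^sup>2 * u i = (K i i - (\<tau> (int i) + L\<^sup>2 * (\<tau> (int i - 1) + \<tau> (int i + 1) - 2 * \<tau> (int i)))) / D (int i)"
        using Dpos[of i] by (simp add: M_def u_def field_simps) (simp add: D_def algebra_simps)
      then show ?thesis
        using div[where i = i, OF kb(3)[where i = i]] by (simp add: h_def mult_ac)
    qed
    have M2: "\<bar>M i (Suc i) * M (Suc i) i - L\<^sup>2 * v i\<bar> \<le> 3 * L ^ 4 * (h i (Suc i) * h (Suc i) i)" for i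
    proof -
      define H where "H = 48 * sandwich \<tau> geo i (Suc i)"
      define x where "x = K i (Suc i)"
      define y where "y = \<tau> (int i) - \<tau> (int i + 1)"
      have H0: "H \<ge> 0" using gnn by (simp add: H_def)
      have Dp: "D (int i) > 0" "D (int i + 1) > 0"
        using Dpos[of i] Dpos[of "Suc i"] by (auto simp: add.commute)
      have "\<bar>x\<bar> \<le> L * H" using kb(2)[where i = i and j = "Suc i"] by (simp add: x_def H_def band_def mult_ac)
      moreover have "\<bar>x - L * y\<bar> \<le> L ^ 3 * H" using kb(4)[where i = i] by (simp add: x_def y_def H_def mult_ac)
      ultimately have sq: "\<bar>x * x - L\<^sup>2 * y\<^sup>2\<bar> \<le> 3 * L ^ 4 * (H * H)"
        by (rule abs_square_diff_le[OF L H0])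
      have "M i (Suc i) * M (Suc i) i = x * x / (D (int i) * D (int i + 1))"
        by (simp add: M_def x_def K_def sandwich_commute[of _ _ "Suc i" i] add.commute)
      moreover have "v i = y\<^sup>2 / (D (int i) * D (int i + 1))"
        by (simp add: v_def y_def D_def)
      ultimately have "M i (Suc i) * M (Suc i) i - L\<^sup>2 * v i = (x * x - L\<^sup>2 * y\<^sup>2) / (D (int i) * D (int i + 1))"
        by (simp add: diff_divide_distrib)
      then have "\<bar>M i (Suc i) * M (Suc i) i - L\<^sup>2 * v i\<bar>
         = \<bar>x * x - L\<^sup>2 * y\<^sup>2\<bar> * ((1 / D (int i)) * (1 / D (int i + 1)))"
        using Dp by (simp add: abs_mult)
      also have "\<dots> \<le> (3 * L ^ 4 * (H * H)) * (B * B)"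
        using Dp invB[of i] invB[of "Suc i"] B(1) by (intro mult_mono sq) (auto simp: add.commute)
      also have "\<dots> = 3 * L ^ 4 * (h i (Suc i) * h (Suc i) i)"
        by (simp add: h_def H_def sandwich_commute[of _ _ "Suc i" i] mult_ac)
      finally show ?thesis .
    qed
    have fin: "\<bar>leibniz_det {..<Suc N} (\<lambda>i j. of_bool (i = j) - K i j)
        - (\<Prod>i<Suc N. D (int i)) * (1 - L\<^sup>2 * ((\<Sum>i<Suc N. u i) + (\<Sum>i<N. v i)))\<bar>
        \<le> (\<Prod>i<Suc N. D (int i)) * (3 * L ^ 4 * exp (48 * B * R))" (is "?l \<le> ?r") for N
    proof -
      have "D (int i) * M i j = K i j - of_bool (i = j) * \<tau> (int i)" for i j
        using Dpos[of i] by (simp add: M_def)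
      then have "of_bool (i = j) - K i j = D (int i) * (of_bool (i = j) - M i j)" for i j
        by (simp add: right_diff_distrib) (simp add: D_def)
      then have "leibniz_det {..<Suc N} (\<lambda>i j. of_bool (i = j) - K i j) =
         (\<Prod>i<Suc N. D (int i)) * leibniz_det {..<Suc N} (\<lambda>i j. of_bool (i = j) - M i j)"
        by (simp only: leibniz_det_scale_rows[of _ "\<lambda>i. D (int i)"])
      then have "?l = (\<Prod>i<Suc N. D (int i)) * \<bar>leibniz_det {..<Suc N} (\<lambda>i j. of_bool (i = j) - M i j)
          - (1 - L\<^sup>2 * ((\<Sum>i<Suc N. u i) + (\<Sum>i<N. v i)))\<bar>"
        using Dpos by (simp add: right_diff_distrib[symmetric] abs_mult abs_of_nonneg prod_nonneg less_imp_le
            del: prod.lessThan_Suc sum.lessThan_Suc)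
      also have "\<dots> \<le> ?r"
        using Dpos by (intro mult_left_mono leibniz_det_approx[OF L M0 hnn M1 M2 hR] prod_nonneg) (auto intro: less_imp_le)
      finally show ?thesis .
    qed
    have "(\<lambda>N. leibniz_det {..<N} (\<lambda>i j. of_bool (i = j) - K i j)) \<longlonglongrightarrow> fredholm_det K UNIV"
    proof (rule fredholm_det_limit[OF kb(1)])
      show "(\<Sum>i<N. \<Sum>j<N. 36 * sandwich \<tau> geo i j) \<le> 36 * R" for N
        using R[of N] by (simp add: sum_distrib_left[symmetric])
    qed
    then have "(\<lambda>N. leibniz_det {..<Suc N} (\<lambda>i j. of_bool (i = j) - K i j)) \<longlonglongrightarrow> fredholm_det K UNIV"
      by (rule LIMSEQ_Suc)
    then have "(\<lambda>N. \<bar>leibniz_det {..<Suc N} (\<lambda>i j. of_bool (i = j) - K i j)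
        - (\<Prod>i<Suc N. D (int i)) * (1 - L\<^sup>2 * ((\<Sum>i<Suc N. u i) + (\<Sum>i<N. v i)))\<bar>)
        \<longlonglongrightarrow> \<bar>fredholm_det K UNIV - P * (1 - L\<^sup>2 * c)\<bar>"
      by (intro tendsto_rabs tendsto_diff tendsto_mult tendsto_const limP limc)
    moreover have "(\<lambda>N. (\<Prod>i<Suc N. D (int i)) * (3 * L ^ 4 * exp (48 * B * R)))
        \<longlonglongrightarrow> P * (3 * L ^ 4 * exp (48 * B * R))"
      by (intro tendsto_mult tendsto_const limP)
    ultimately show ?thesis
      unfolding K_def[symmetric] by (rule LIMSEQ_le) (use fin in blast)
  qed
  have c: "c = (\<tau> (- 1) - \<tau> 0) / (1 - \<tau> 0)"
    using Dpos[of 0] by (simp add: c_def D_def field_simps)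
  show ?thesis
    by (rule that[of "3 * exp (48 * B * R)"])
       (use main in \<open>simp add: P_def c D_def mult_ac\<close>)
qed

section \<open>From half-integers to natural and integer indices\<close>

lemma Zp_eq_shifted_range:
  assumes "s \<in> Zp"
  shows "Zp = range (\<lambda>k::int. - s - 1 - real_of_int k)"
proof -
  obtain m where m: "s = real_of_int m + 1/2" using assms by (auto simp: Zp_def)
  show ?thesis
  proof (intro equalityI subsetI)
    fix x assume "x \<in> Zp"
    then obtain n where "x = real_of_int n + 1/2" by (auto simp: Zp_def)
    then have "x = - s - 1 - real_of_int (- n - m - 2)" by (simp add: m)
    then show "x \<in> range (\<lambda>k::int. - s - 1 - real_of_int k)" by blast
  next
    fix x assume "x \<in> range (\<lambda>k::int. - s - 1 - real_of_int k)"
    then obtain k where "x = - s - 1 - real_of_int k" by blast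
    then have "x = real_of_int (- m - 2 - k) + 1/2" by (simp add: m)
    then show "x \<in> Zp" unfolding Zp_def by blast
  qed
qed

lemma Qsig_eq_fredholm_bessel:
  assumes "s \<in> Zp"
  shows "Qsig \<sigma> L s = fredholm_det (bessel_kernel (\<lambda>k. \<sigma> (- s - 1 - real_of_int k)) L) UNIV"
proof -
  obtain m where m: "s = real_of_int m + 1/2" using assms by (auto simp: Zp_def)
  have E: "{a \<in> Zp. s < a} = (\<lambda>i::nat. s + 1 + real i) ` UNIV"
  proof (intro equalityI subsetI)
    fix x assume "x \<in> {a \<in> Zp. s < a}"
    then obtain n where n: "x = real_of_int n + 1/2" "n > m" by (auto simp: Zp_def m)
    then have "x = s + 1 + real (nat (n - m - 1))" by (simp add: m)
    then show "x \<in> (\<lambda>i::nat. s + 1 + real i) ` UNIV" by blast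
  next
    fix x assume "x \<in> (\<lambda>i::nat. s + 1 + real i) ` UNIV"
    then obtain i where "x = s + 1 + real i" by blast
    then have "x = real_of_int (m + 1 + int i) + 1/2" "x > s" by (simp_all add: m)
    then show "x \<in> {a \<in> Zp. s < a}" unfolding Zp_def by blast
  qed
  have "Ksig \<sigma> L (s + 1 + real i) (s + 1 + real j) = bessel_kernel (\<lambda>k. \<sigma> (- s - 1 - real_of_int k)) L i j" for i j
  proof -
    have inj: "inj (\<lambda>k::int. - s - 1 - real_of_int k)" by (auto simp: inj_def)
    \<comment> \<open>The half-integral parts cancel, so the floor is taken of an exact
      integer.\<close>
    have fl: "\<lfloor>s + 1 + real i + (- s - 1 - real_of_int k)\<rfloor> = int i - k" for i :: nat and k
    proof -
      have "s + 1 + real i + (- s - 1 - real_of_int k) = real_of_int (int i - k)" by simp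
      then show ?thesis by (simp only: floor_of_int)
    qed
    show ?thesis
      unfolding Ksig_def sandwich_def Zp_eq_shifted_range[OF assms]
      by (subst infsum_reindex[OF inj]) (simp add: o_def fl mult.assoc)
  qed
  moreover have "inj (\<lambda>i::nat. s + 1 + real i)" by (auto simp: inj_def)
  ultimately show ?thesis
    unfolding Qsig_def E by (simp add: fredholm_det_image)
qed

text \<open>The hypothesis concerns l < 0, whereas k >= 0 means l <= - s - 1; for negative
  \<open>s\<close> this may add finitely many l > 0.\<close>

lemma summable_on_shifted:
  assumes s: "s \<in> Zp" and sum: "\<sigma> summable_on {l \<in> Zp. l < 0}"
  shows "(\<lambda>k::int. \<sigma> (- s - 1 - real_of_int k) :: real) summable_on {0..}"
proof -
  let ?f = "\<lambda>k::int. - s - 1 - real_of_int k"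
  define A where "A = {k. ?f k < 0}"
  have "?f ` A \<subseteq> {l \<in> Zp. l < 0}"
    unfolding Zp_eq_shifted_range[OF s] A_def by auto
  then have "\<sigma> summable_on (?f ` A)"
    by (rule summable_on_subset_banach[OF sum])
  moreover have "inj_on ?f A" by (auto simp: inj_on_def)
  ultimately have 1: "(\<lambda>k. \<sigma> (?f k)) summable_on A"
    by (simp add: summable_on_reindex o_def)
  have "{0..} - A \<subseteq> {0..\<lceil>- s\<rceil>}"
    by (auto simp: A_def) linarith
  then have "finite ({0..} - A)" by (rule finite_subset) simp
  then have "(\<lambda>k. \<sigma> (?f k)) summable_on ({0..} - A)" by (rule summable_on_finite)
  then have "(\<lambda>k. \<sigma> (?f k)) summable_on (A \<union> ({0..} - A))" by (rule summable_on_union[OF 1])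
  then show ?thesis by (rule summable_on_subset_banach) auto
qed

text \<open>One zero factor makes all later partial products vanish, hence also their limit.
  Positivity of \<open>Q0\<close> thus forces every \<open>\<tau> (int i)\<close> below 1.\<close>

lemma prodinf_nonzero_imp_factor_nonzero:
  fixes f :: "nat \<Rightarrow> real"
  assumes "convergent_prod f" "prodinf f \<noteq> 0"
  shows "f i \<noteq> 0"
proof
  assume "f i = 0"
  then have "\<forall>\<^sub>F n in sequentially. (\<Prod>j\<le>n. f j) = 0"
    by (intro eventually_mono[OF eventually_ge_at_top[of i]] prod_zero bexI[of _ i]) auto
  then have "(\<lambda>n. \<Prod>j\<le>n. f j) \<longlonglongrightarrow> 0" by (rule tendsto_eventually)
  with convergent_prod_LIMSEQ[OF assms(1)] have "prodinf f = 0" by (rule LIMSEQ_unique)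
  with assms(2) show False by simp
qed

section \<open>Passing to the logarithm\<close>

lemma log_expansion:
  fixes Q :: "real \<Rightarrow> real"
  assumes Q: "\<And>L. 0 \<le> L \<Longrightarrow> L \<le> 1 \<Longrightarrow> \<bar>Q L - q * (1 - c * L\<^sup>2)\<bar> \<le> q * (C * L ^ 4)" and q: "q > 0"
  shows "\<exists>Lst>0. (\<forall>L. 0 \<le> L \<and> L < Lst \<longrightarrow> Q L > 0) \<and>
    (\<lambda>L. ln (Q L) - (ln q - c * L\<^sup>2)) \<in> O[at_right 0](\<lambda>L. L ^ 4)"
proof -
  define A where "A = \<bar>c\<bar> + \<bar>C\<bar> + 1"
  \<comment> \<open>For \<open>L < r\<close> one has A L^2 <= A L <= 1/2, the range in which |ln (1
    + y) - y| <= 2 y^2 is available.\<close>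
  define r where "r = 1 / (2 * A)"
  have A: "A \<ge> 1" by (simp add: A_def)
  then have r: "0 < r" "r \<le> 1" by (auto simp: r_def field_simps)
  have key: "Q L > 0 \<and> \<bar>ln (Q L) - (ln q - c * L\<^sup>2)\<bar> \<le> (\<bar>C\<bar> + 2 * A\<^sup>2) * L ^ 4"
    if L: "0 \<le> L" "L < r" for L
  proof -
    \<comment> \<open>The relative deviation from \<open>q\<close>: it equals - c L^2 up to O(L^4),
      so replacing ln (1 + y) by y costs only y^2 = O(L^4).\<close>
    define y where "y = Q L / q - 1"
    have L1: "L \<le> 1" using L r by linarith
    have L2: "L\<^sup>2 \<le> L" using L L1 by (simp add: power2_eq_square mult_left_le)
    have L4: "L ^ 4 \<le> L\<^sup>2" using L L1 by (intro power_decreasing) auto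
    have "Q L - q * (1 - c * L\<^sup>2) = q * (y + c * L\<^sup>2)" using q by (simp add: y_def field_simps)
    then have "q * \<bar>y + c * L\<^sup>2\<bar> \<le> q * (C * L ^ 4)"
      using Q[OF L(1) L1] q by (simp add: abs_mult)
    then have y1: "\<bar>y + c * L\<^sup>2\<bar> \<le> C * L ^ 4" using q by simp
    have "C * L ^ 4 \<le> \<bar>C\<bar> * L ^ 4" by (intro mult_right_mono) auto
    with y1 have y2: "\<bar>y + c * L\<^sup>2\<bar> \<le> \<bar>C\<bar> * L ^ 4" by linarith
    have "\<bar>C\<bar> * L ^ 4 \<le> \<bar>C\<bar> * L\<^sup>2" by (intro mult_left_mono L4) auto
    moreover have "\<bar>c * L\<^sup>2\<bar> = \<bar>c\<bar> * L\<^sup>2" by (simp add: abs_mult)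
    ultimately have "\<bar>y\<bar> \<le> \<bar>c\<bar> * L\<^sup>2 + \<bar>C\<bar> * L\<^sup>2" using y2 by linarith
    also have "\<dots> \<le> A * L\<^sup>2" by (simp add: A_def algebra_simps)
    finally have y3: "\<bar>y\<bar> \<le> A * L\<^sup>2" .
    have "A * L\<^sup>2 \<le> A * r" using L L2 A by (intro mult_left_mono) auto
    also have "\<dots> = 1 / 2" using A by (simp add: r_def)
    finally have y4: "\<bar>y\<bar> \<le> 1 / 2" using y3 by linarith
    have QL: "Q L = q * (1 + y)" using q by (simp add: y_def)
    have pos: "1 + y > 0" using y4 by linarith
    have "y\<^sup>2 \<le> (A * L\<^sup>2)\<^sup>2" using y3 by (intro abs_le_square_iff[THEN iffD1]) auto
    also have "\<dots> = A\<^sup>2 * L ^ 4" by (simp add: power_mult_distrib)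
    finally have "\<bar>ln (1 + y) - y\<bar> \<le> 2 * (A\<^sup>2 * L ^ 4)"
      using abs_ln_one_plus_x_minus_x_bound[OF y4] by linarith
    moreover have "ln (Q L) = ln q + ln (1 + y)" using q pos by (simp add: QL ln_mult)
    ultimately have "\<bar>ln (Q L) - (ln q - c * L\<^sup>2)\<bar> \<le> \<bar>C\<bar> * L ^ 4 + 2 * (A\<^sup>2 * L ^ 4)"
      using y2 by linarith
    also have "\<dots> = (\<bar>C\<bar> + 2 * A\<^sup>2) * L ^ 4" by (simp add: algebra_simps)
    finally show ?thesis using q pos by (simp add: QL)
  qed
  have "\<forall>\<^sub>F L in at_right 0. norm (ln (Q L) - (ln q - c * L\<^sup>2)) \<le> (\<bar>C\<bar> + 2 * A\<^sup>2) * norm (L ^ 4)"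
    using eventually_at_right_real[OF r(1)]
  proof eventually_elim
    case (elim L)
    then show ?case using key[of L] by simp
  qed
  then have "(\<lambda>L. ln (Q L) - (ln q - c * L\<^sup>2)) \<in> O[at_right 0](\<lambda>L. L ^ 4)"
    by (rule bigoI)
  then show ?thesis using key r(1) by blast
qed

theorem mainTheorem2:
  fixes \<sigma> :: "real \<Rightarrow> real" and s :: real
  assumes "\<forall>l\<in>Zp. 0 \<le> \<sigma> l \<and> \<sigma> l \<le> 1"
    and "\<sigma> summable_on {l \<in> Zp. l < 0}"
    and "s \<in> Zp"
    and "Q0 \<sigma> s > 0"
  shows "\<exists>Lst>0. (\<forall>L. 0 \<le> L \<and> L < Lst \<longrightarrow> Qsig \<sigma> L s > 0) \<and>
    (\<lambda>L. ln (Qsig \<sigma> L s)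
          - (ln (Q0 \<sigma> s) - (\<sigma> (- s) - \<sigma> (- s - 1)) / (1 - \<sigma> (- 1 - s)) * L ^ 2))
      \<in> O[at_right 0](\<lambda>L. L ^ 4)"
proof -
  define \<tau> where "\<tau> = (\<lambda>k::int. \<sigma> (- s - 1 - real_of_int k))"
  have \<tau>: "0 \<le> \<tau> k \<and> \<tau> k \<le> 1" for k
    using assms(1) unfolding Zp_eq_shifted_range[OF assms(3)] \<tau>_def by blast
  have sum: "\<tau> summable_on {0..}"
    unfolding \<tau>_def by (rule summable_on_shifted[OF assms(3,2)])
  have Q0: "Q0 \<sigma> s = (\<Prod>i. 1 - \<tau> (int i))"
  proof -
    have "- (real i + 1) - s = - s - 1 - real_of_int (int i)" for i by simp
    then show ?thesis unfolding Q0_def \<tau>_def by (simp only:)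
  qed
  have "convergent_prod (\<lambda>i. 1 - \<tau> (int i))"
    by (rule convergent_prod_one_minus[OF summable_on_atLeast_0_imp_summable[OF sum]]) (use \<tau> in auto)
  then have "\<tau> (int i) \<noteq> 1" for i
    using prodinf_nonzero_imp_factor_nonzero[of "\<lambda>i. 1 - \<tau> (int i)" i] assms(4) Q0 by simp
  then have lt1: "\<tau> (int i) < 1" for i using \<tau>[of "int i"] by (simp add: less_le)
  obtain C where C: "\<And>L. 0 \<le> L \<Longrightarrow> L \<le> 1 \<Longrightarrow>
     \<bar>fredholm_det (bessel_kernel \<tau> L) UNIV
       - (\<Prod>i. 1 - \<tau> (int i)) * (1 - (\<tau> (- 1) - \<tau> 0) / (1 - \<tau> 0) * L\<^sup>2)\<bar> \<le> (\<Prod>i. 1 - \<tau> (int i)) * (C * L ^ 4)"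
    using fredholm_bessel_approx[OF \<tau> sum lt1] by blast
  \<comment> \<open>In the shifted coordinate l = - s sits at k = -1, just outside the index set of
    the determinant, and l = - s - 1 at k = 0.\<close>
  have "- 1 - s = - s - 1" by simp
  then have \<tau>01: "\<sigma> (- s) = \<tau> (- 1)" "\<sigma> (- s - 1) = \<tau> 0" "\<sigma> (- 1 - s) = \<tau> 0"
    by (simp_all only: \<tau>_def) simp_all
  show ?thesis
    unfolding Qsig_eq_fredholm_bessel[OF assms(3), of \<sigma>, folded \<tau>_def] Q0 \<tau>01
    by (rule log_expansion[OF C]) (use assms(4) Q0 in simp_all)
qed

end
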